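(* Let $s\in(0,1)$, let $L\in\mathcal L_*$, and let $\Omega\subset\mathbb R^n$ be a $C^1$ domain with $0\in\partial\Omega$. Let $u_1,u_2\in L^\infty(\mathbb R^n)$ be viscosity solutions of $$Lu_1=Lu_2=0\ \text{ in } B_1\cap\Omega,\qquad u_1=u_2=0\ \text{ in } B_1\setminus\Omega.$$ Assume that $u_1\ge0$ and $u_2\ge0$ in $\mathbb R^n$, and that $\sup_{B_{1/2}}u_1=\sup_{B_{1/2}}u_2=1$. Then $$0<C^{-1}\le\frac{u_1}{u_2}\le C\qquad\text{in } B_{1/2}\cap\Omega,$$ where $C$ depends only on $n$, $s$, $\Omega$, $\lambda$, $\Lambda$.
   Context: $B_r$ is the open ball of radius $r$ centered at $0$ in $\mathbb R^n$. Fix $0<\lambda\le\Lambda$ (the ellipticity constants). $\mathcal L_*$ is the class of all operators of the form $$Lu(x)=\int_{\mathbb R^n}\left(\frac{u(x+y)+u(x-y)}{2}-u(x)\right)\frac{a(y/|y|)}{|y|^{n+2s}}\,dy,$$ with $a:S^{n-1}\to\mathbb R$ measurable and $\lambda\le a(\theta)\le\Lambda$ for all $\theta\in S^{n-1}$. Viscosity solutions: solutions are continuous in $B_1$. $Lu\ge f$ (resp. $\le f$) in an open set $D$ in the viscosity sense means: whenever $x_0\in D$, $N\subset D$ is a neighborhood of $x_0$, $\varphi\in C^2(N)$, $\varphi(x_0)=u(x_0)$ and $\varphi\ge u$ (resp. $\varphi\le u$) in $N$, the function $v$ equal to $\varphi$ in $N$ and to $u$ in $\mathbb R^n\setminus N$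 satisfies $Lv(x_0)\ge f(x_0)$ (resp. $\le f(x_0)$). $Lu=f$ means both inequalities hold. *)

theory Defs
  imports "HOL-Analysis.Analysis"
begin

text \<open>Real-valued functions of class $C^1$ (on the whole space) and $C^2$ (on an open set), in terms
  of the gradient \<open>G\<close> and the Hessian \<open>H\<close> (the derivative of the gradient).\<close>

definition C1_fun :: "('a::euclidean_space \<Rightarrow> real) \<Rightarrow> bool" where
  "C1_fun g \<longleftrightarrow> (\<exists>G. (\<forall>x. GDERIV g x :> G x) \<and> continuous_on UNIV G)"

definition C2_on :: "'a::euclidean_space set \<Rightarrow> ('a \<Rightarrow> real) \<Rightarrow> bool" where
  "C2_on N \<phi> \<longleftrightarrow>
     (\<exists>G (H :: 'a \<Rightarrow> 'a \<Rightarrow>\<^sub>L 'a).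
        (\<forall>x\<in>N. GDERIV \<phi> x :> G x \<and> (G has_derivative blinfun_apply (H x)) (at x)) \<and>
        continuous_on N H)"

text \<open>An open set which, near each boundary point and in suitable orthonormal coordinates with last
  axis \<open>e\<close>, is the strict epigraph of a $C^1$ function of the other coordinates. The vector
  \<open>x - (x \<bullet> e) *\<^sub>R e\<close> is the projection of \<open>x\<close> to the hyperplane orthogonal to \<open>e\<close>; every $C^1$
  function on that hyperplane is the restriction of one on the whole space, so asking for a globally
  defined \<open>g\<close> is no restriction. Connectedness is not required.\<close>

definition C1_domain :: "'a::euclidean_space set \<Rightarrow> bool" where
  "C1_domain \<Omega> \<longleftrightarrow> open \<Omega> \<and>
     (\<forall>p\<in>frontier \<Omega>. \<exists>r>0. \<exists>e g. norm e = 1 \<and> C1_fun g \<and>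
        \<Omega> \<inter> ball p r = {x \<in> ball p r. g (x - (x \<bullet> e) *\<^sub>R e) < x \<bullet> e})"

definition nonlocal_integrand ::
    "real \<Rightarrow> ('a::euclidean_space \<Rightarrow> real) \<Rightarrow> ('a \<Rightarrow> real) \<Rightarrow> 'a \<Rightarrow> 'a \<Rightarrow> real" where
  "nonlocal_integrand s a u x y =
     ((u (x + y) + u (x - y)) / 2 - u x) *
     (a (y /\<^sub>R norm y) / norm y powr (real DIM('a) + 2 * s))"

text \<open>The value of the operator is extended real: a $C^2$ test function on an open set \<open>N\<close> may blow up
  at the boundary of \<open>N\<close>, in which case the integral can be \<open>\<infinity>\<close> (touching from above) or
  \<open>-\<infinity>\<close> (touching from below). The Bochner integral would return \<open>0\<close> there.\<close>

definition nonlocal_op ::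
    "real \<Rightarrow> ('a::euclidean_space \<Rightarrow> real) \<Rightarrow> ('a \<Rightarrow> real) \<Rightarrow> 'a \<Rightarrow> ereal" where
  "nonlocal_op s a u x =
     enn2ereal (\<integral>\<^sup>+ y. ennreal (nonlocal_integrand s a u x y) \<partial>lebesgue) -
     enn2ereal (\<integral>\<^sup>+ y. ennreal (- nonlocal_integrand s a u x y) \<partial>lebesgue)"

lemma nonlocal_op_eq_integral:
  assumes "integrable lebesgue (nonlocal_integrand s a u x)"
  shows "nonlocal_op s a u x = ereal (\<integral> y. nonlocal_integrand s a u x y \<partial>lebesgue)"
proof -
  let ?g = "nonlocal_integrand s a u x"
  have fin: "(\<integral>\<^sup>+ y. ennreal (?g y) \<partial>lebesgue) \<noteq> \<infinity>" "(\<integral>\<^sup>+ y. ennreal (- ?g y) \<partial>lebesgue) \<noteq> \<infinity>"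
    using assms by (auto simp: real_integrable_def)
  have r: "enn2ereal z = ereal (enn2real z)" if "z \<noteq> \<infinity>" for z
    using that by (cases z) (auto simp: enn2ereal_ennreal)
  show ?thesis
    unfolding nonlocal_op_def real_lebesgue_integral_def[OF assms] using fin by (simp add: r)
qed

text \<open>Only the values of \<open>a\<close> on the unit sphere matter. A function on the sphere is measurable with
  respect to the (completed) surface measure iff its extension homogeneous of degree \<open>0\<close> is Lebesgue
  measurable; Borel functions on the sphere are included.\<close>

definition L_star ::
    "real \<Rightarrow> real \<Rightarrow> real \<Rightarrow> (('a::euclidean_space \<Rightarrow> real) \<Rightarrow> 'a \<Rightarrow> ereal) set" where
  "L_star s lam Lam =
     {nonlocal_op s a | a.
        (\<lambda>y. a (y /\<^sub>R norm y)) \<in> borel_measurable lebesgue \<and>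
        (\<forall>\<theta>\<in>sphere 0 1. lam \<le> a \<theta> \<and> a \<theta> \<le> Lam)}"

definition visc_ge ::
    "(('a::euclidean_space \<Rightarrow> real) \<Rightarrow> 'a \<Rightarrow> ereal) \<Rightarrow> ('a \<Rightarrow> real) \<Rightarrow> ('a \<Rightarrow> real) \<Rightarrow> 'a set \<Rightarrow> bool" where
  "visc_ge L u f D \<longleftrightarrow>
     (\<forall>x0\<in>D. \<forall>N \<phi>. open N \<longrightarrow> x0 \<in> N \<longrightarrow> N \<subseteq> D \<longrightarrow> C2_on N \<phi> \<longrightarrow>
        \<phi> x0 = u x0 \<longrightarrow> (\<forall>x\<in>N. \<phi> x \<ge> u x) \<longrightarrow>
        L (\<lambda>x. if x \<in> N then \<phi> x else u x) x0 \<ge> ereal (f x0))"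

definition visc_le ::
    "(('a::euclidean_space \<Rightarrow> real) \<Rightarrow> 'a \<Rightarrow> ereal) \<Rightarrow> ('a \<Rightarrow> real) \<Rightarrow> ('a \<Rightarrow> real) \<Rightarrow> 'a set \<Rightarrow> bool" where
  "visc_le L u f D \<longleftrightarrow>
     (\<forall>x0\<in>D. \<forall>N \<phi>. open N \<longrightarrow> x0 \<in> N \<longrightarrow> N \<subseteq> D \<longrightarrow> C2_on N \<phi> \<longrightarrow>
        \<phi> x0 = u x0 \<longrightarrow> (\<forall>x\<in>N. \<phi> x \<le> u x) \<longrightarrow>
        L (\<lambda>x. if x \<in> N then \<phi> x else u x) x0 \<le> ereal (f x0))"

definition visc_eq ::
    "(('a::euclidean_space \<Rightarrow> real) \<Rightarrow> 'a \<Rightarrow> ereal) \<Rightarrow> ('a \<Rightarrow> real) \<Rightarrow> ('a \<Rightarrow> real) \<Rightarrow> 'a set \<Rightarrow> bool" where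
  "visc_eq L u f D \<longleftrightarrow> visc_ge L u f D \<and> visc_le L u f D"

definition L_infty :: "('a::euclidean_space \<Rightarrow> real) set" where
  "L_infty = {u. u \<in> borel_measurable lebesgue \<and> (\<exists>M. AE x in lebesgue. \<bar>u x\<bar> \<le> M)}"

end

(* All kernels of the class are comparable to |z|^(-n-2s) on the whole space, so each step evaluates
   the equation at one well-chosen touching point, and no regularity theory is needed. With
   I(u) = int u(y) (1 + |y|)^(-n-2s) dy:
   - a nonnegative supersolution near p satisfies I(u) <= C u(p) (touch by a paraboloid from below);
   - u, extended by 0 across the boundary, is a subsolution in the unit ball, and nonnegative
     subsolutions satisfy u <= C I(u) in smaller balls (touch from above).
   With the normalization sup u_i = 1 these give I(u_i) <= C, u_i <= C in the ball of radius 3/4 and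
   u_i >= c in a fixed ball B contained in Omega.
   For u_1 <= C u_2, argue by contradiction with a doubling of variables: the positive mass of C u_2
   on B dominates all error terms once C is large. *)
theory Submission
  imports Defs
begin

section \<open>The fractional kernel and Lebesgue measure\<close>

text \<open>Viscosity inequalities hold only where a smooth function touches, and
  \<open>u1 - C * u2\<close> is not known to satisfy one; so the two equations are used at nearby
  but different points \<open>x\<close> and \<open>y\<close>. This works because the kernel is a
  function of the increment alone: both inequalities are integrals against the same
  \<open>K z\<close> and may be subtracted pointwise. The equation for \<open>u2\<close> is
  available only inside \<Omega>, so \<open>y\<close> has to be forced there; \<open>x\<close>
  causes no such trouble, as zero extension leaves \<open>u1\<close> a subsolution in the whole
  ball.

  The order of choices is decisive. The constant \<open>C\<close> is fixed first and sees only the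
  data. The penalty \<open>E\<close> depends on the modulus of continuity of \<open>u1\<close>, so
  it must drop out of the final inequality; the touching radius \<open>d\<close>, chosen last, makes
  it do so.\<close>

definition frac_kernel :: "real \<Rightarrow> 'a::euclidean_space \<Rightarrow> real" where
  "frac_kernel s z = norm z powr - (real DIM('a) + 2 * s)"

text \<open>The kernel with its singularity removed. Away from \<open>x\<close> it is comparable to
  \<open>frac_kernel s (y - x)\<close>, uniformly for \<open>x\<close> in the unit ball, so one
  weighted integral serves every touching point.\<close>

definition tail_weight :: "real \<Rightarrow> 'a::euclidean_space \<Rightarrow> real" where
  "tail_weight s y = (1 + norm y) powr - (real DIM('a) + 2 * s)"

lemma frac_kernel_measurable [measurable]: "frac_kernel s \<in> borel_measurable lebesgue"
  unfolding frac_kernel_def by (intro measurable_completion) measurable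

lemma tail_weight_measurable [measurable]: "tail_weight s \<in> borel_measurable lebesgue"
  unfolding tail_weight_def by (intro measurable_completion) measurable

lemma frac_kernel_nonneg [simp]: "0 \<le> frac_kernel s z"
  by (simp add: frac_kernel_def)

lemma tail_weight_pos [simp]: "0 < tail_weight s z"
  using norm_ge_zero[of z] by (auto simp: tail_weight_def simp del: norm_ge_zero)

lemma tail_weight_nonneg [simp]: "0 \<le> tail_weight s z"
  using tail_weight_pos less_imp_le by blast

lemma lebesgue_distr_isometry:
  fixes x :: "'a::euclidean_space"
  assumes "\<bar>c\<bar> = 1"
  shows "distr lebesgue lebesgue (\<lambda>z. x + c *\<^sub>R z) = lebesgue"
    and "(\<lambda>z. x + c *\<^sub>R z) \<in> lebesgue \<rightarrow>\<^sub>M lebesgue"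
proof -
  have c: "c \<noteq> 0" using assms by auto
  \<comment> \<open>The affine change of variables scales each coordinate by its own factor; equal
    factors turn the coordinate sum into \<open>x + c *\<^sub>R z\<close>, and the Jacobian is a
    power of \<open>\<bar>c\<bar> = 1\<close>.\<close>
  have T: "(\<lambda>z. x + (\<Sum>j\<in>Basis. (c * (z \<bullet> j)) *\<^sub>R j)) = (\<lambda>z. x + c *\<^sub>R z)"
    by (auto simp: fun_eq_iff scaleR_sum_right[symmetric] euclidean_representation
        simp flip: scaleR_scaleR)
  show "(\<lambda>z. x + c *\<^sub>R z) \<in> lebesgue \<rightarrow>\<^sub>M lebesgue"
    using lebesgue_affine_measurable[where c = "\<lambda>_. c" and t = x] c by (simp only: T) simp
  have "lebesgue = density (distr lebesgue lebesgue (\<lambda>z. x + c *\<^sub>R z)) (\<lambda>_. (\<Prod>j\<in>(Basis::'a set). \<bar>c\<bar>))"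
    using lebesgue_affine_euclidean[where c = "\<lambda>_. c" and t = x] c by (simp only: T) simp
  then show "distr lebesgue lebesgue (\<lambda>z. x + c *\<^sub>R z) = lebesgue"
    by (simp add: assms ennreal_1[symmetric] density_1 del: ennreal_1) (simp add: density_1)
qed

lemmas lebesgue_distr_plus = lebesgue_distr_isometry(1)[where c = 1, simplified]
lemmas lebesgue_distr_minus = lebesgue_distr_isometry(1)[where c = "-1", simplified]
lemmas measurable_lebesgue_plus = lebesgue_distr_isometry(2)[where c = 1, simplified]
lemmas measurable_lebesgue_minus = lebesgue_distr_isometry(2)[where c = "-1", simplified]

lemma borel_measurable_lebesgue_plus:
  assumes "u \<in> borel_measurable lebesgue"
  shows "(\<lambda>z. u (x + z)) \<in> borel_measurable lebesgue" "(\<lambda>z. u (x - z)) \<in> borel_measurable lebesgue"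
  using measurable_compose[OF measurable_lebesgue_plus assms]
    measurable_compose[OF measurable_lebesgue_minus assms] by auto

lemma AE_lebesgue_plus:
  assumes "AE y in lebesgue. P y"
  shows "AE z in lebesgue. P (x + z)" "AE z in lebesgue. P (x - z)"
  using AE_distrD[OF measurable_lebesgue_plus[of x], of P] AE_distrD[OF measurable_lebesgue_minus[of x], of P] assms
  unfolding lebesgue_distr_plus lebesgue_distr_minus by blast+

text \<open>Symmetrizing \<open>u * tail_weight s\<close> about a touching point leaves its integral
  equal to \<open>weighted_mass s u\<close>: the dependence on the point disappears.\<close>

lemma integrable_lebesgue_average:
  fixes f :: "'a::euclidean_space \<Rightarrow> real"
  assumes f: "integrable lebesgue f"
  shows "integrable lebesgue (\<lambda>z. (f (x + z) + f (x - z)) / 2)"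
    and "(\<integral>z. (f (x + z) + f (x - z)) / 2 \<partial>lebesgue) = (\<integral>y. f y \<partial>lebesgue)"
proof -
  have m: "f \<in> borel_measurable lebesgue" using f by auto
  have i: "integrable lebesgue (\<lambda>z. f (x + z))" "integrable lebesgue (\<lambda>z. f (x - z))"
    using f integrable_distr[OF measurable_lebesgue_plus, of x f]
      integrable_distr[OF measurable_lebesgue_minus, of x f]
    by (auto simp: lebesgue_distr_plus lebesgue_distr_minus)
  have "(\<integral>z. f (x + z) \<partial>lebesgue) = (\<integral>y. f y \<partial>lebesgue)"
       "(\<integral>z. f (x - z) \<partial>lebesgue) = (\<integral>y. f y \<partial>lebesgue)"
    using integral_distr[OF measurable_lebesgue_plus m] integral_distr[OF measurable_lebesgue_minus m]
    by (auto simp: lebesgue_distr_plus lebesgue_distr_minus)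
  with i show "integrable lebesgue (\<lambda>z. (f (x + z) + f (x - z)) / 2)"
    "(\<integral>z. (f (x + z) + f (x - z)) / 2 \<partial>lebesgue) = (\<integral>y. f y \<partial>lebesgue)"
    by auto
qed

text \<open>Dominate \<open>f\<close> by a sum of constants on balls of radius
  \<open>2 * (r * \<rho> ^ k)\<close>; the integrals of the terms form a geometric series with ratio
  \<rho> to the power \<beta> plus the dimension. The value 1/2 of \<rho> serves a singularity at
  the origin, the value 2 decay at infinity.\<close>

lemma dyadic_integral_bound:
  fixes f :: "'a::euclidean_space \<Rightarrow> real"
  assumes f: "f \<in> borel_measurable lebesgue" "\<And>z. 0 \<le> f z"
    and pos: "0 < r" "0 < \<rho>" "0 \<le> C"
    and ratio: "\<rho> powr (\<beta> + real DIM('a)) < 1"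
    and cover: "\<And>z. f z \<noteq> 0 \<Longrightarrow>
      \<exists>k. norm z < 2 * (r * \<rho> ^ k) \<and> f z \<le> C * (r * \<rho> ^ k) powr \<beta>"
  shows "integrable lebesgue f"
    and "(\<integral>z. f z \<partial>lebesgue) \<le> unit_ball_vol (real DIM('a)) * 2 ^ DIM('a) * C
            / (1 - \<rho> powr (\<beta> + real DIM('a))) * r powr (\<beta> + real DIM('a))"
proof -
  let ?n = "DIM('a)" and ?V = "unit_ball_vol (real DIM('a))"
  define t where "t k = r * \<rho> ^ k" for k
  have t: "0 < t k" for k using pos by (simp add: t_def)
  let ?x = "\<rho> powr (\<beta> + real ?n)"
  have point: "ennreal (f z) \<le> (\<Sum>k. ennreal (C * t k powr \<beta>) * indicator (ball 0 (2 * t k)) z)" for z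
  proof (cases "f z = 0")
    case False
    then obtain k where k: "norm z < 2 * t k" "f z \<le> C * t k powr \<beta>"
      using cover unfolding t_def by blast
    have "ennreal (f z) \<le> ennreal (C * t k powr \<beta>) * indicator (ball 0 (2 * t k)) z"
      using k by (simp add: ennreal_leI)
    also have "\<dots> \<le> (\<Sum>k. ennreal (C * t k powr \<beta>) * indicator (ball 0 (2 * t k)) z)"
      using sum_le_suminf[OF summableI, of "{k}" "\<lambda>k. ennreal (C * t k powr \<beta>) * indicator (ball 0 (2 * t k)) z"]
      by (simp only: sum.insert sum.empty finite.emptyI empty_iff not_False_eq_True add_0_right)
         (simp del: indicator_simps)
    finally show ?thesis .
  qed simp
  have vol: "emeasure lebesgue (ball (0::'a) (2 * t k)) = ennreal (?V * 2 ^ ?n * t k ^ ?n)" for k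
    using emeasure_ball[of "2 * t k" "0::'a"] t[of k] by (simp add: power_mult_distrib mult.assoc)
  have dyadic_term: "ennreal (C * t k powr \<beta>) * emeasure lebesgue (ball (0::'a) (2 * t k))
      = ennreal (?V * 2 ^ ?n * C * r powr (\<beta> + real ?n) * ?x ^ k)" for k
  proof -
    have "C * t k powr \<beta> * (?V * 2 ^ ?n * t k ^ ?n) = ?V * 2 ^ ?n * C * (t k powr \<beta> * t k powr real ?n)"
      using t[of k] by (simp add: powr_realpow)
    also have "t k powr \<beta> * t k powr real ?n = t k powr (\<beta> + real ?n)"
      by (simp add: powr_add)
    also have "t k powr (\<beta> + real ?n) = r powr (\<beta> + real ?n) * ?x ^ k"
    proof -
      have "(\<rho> ^ k) powr (\<beta> + real ?n) = (\<rho> powr real k) powr (\<beta> + real ?n)"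
        using pos by (simp add: powr_realpow)
      also have "\<dots> = ?x powr real k" by (simp add: powr_powr mult.commute)
      also have "\<dots> = ?x ^ k" using pos by (simp add: powr_realpow)
      finally show ?thesis using pos by (simp add: t_def powr_mult)
    qed
    finally have e: "C * t k powr \<beta> * (?V * 2 ^ ?n * t k ^ ?n)
       = ?V * 2 ^ ?n * C * r powr (\<beta> + real ?n) * ?x ^ k" by (simp add: mult.assoc)
    have "ennreal (C * t k powr \<beta>) * ennreal (?V * 2 ^ ?n * t k ^ ?n)
        = ennreal (C * t k powr \<beta> * (?V * 2 ^ ?n * t k ^ ?n))"
      using t[of k] pos by (intro ennreal_mult[symmetric]) auto
    then show ?thesis using vol e by simp
  qed
  let ?B = "?V * 2 ^ ?n * C / (1 - ?x) * r powr (\<beta> + real ?n)"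
  have xx: "0 \<le> ?x" "norm ?x < 1" using ratio by auto
  have "(\<integral>\<^sup>+z. ennreal (f z) \<partial>lebesgue)
      \<le> (\<integral>\<^sup>+z. (\<Sum>k. ennreal (C * t k powr \<beta>) * indicator (ball (0::'a) (2 * t k)) z) \<partial>lebesgue)"
    using point by (auto intro!: nn_integral_mono)
  also have "\<dots> = (\<Sum>k. ennreal (C * t k powr \<beta>) * emeasure lebesgue (ball (0::'a) (2 * t k)))"
  proof (subst nn_integral_suminf)
    have ball: "ball (0::'a) (2 * t k) \<in> sets lebesgue" for k by simp
    show "(\<lambda>z. ennreal (C * t k powr \<beta>) * indicator (ball (0::'a) (2 * t k)) z) \<in> borel_measurable lebesgue" for k
      by (intro borel_measurable_times_ennreal borel_measurable_const borel_measurable_indicator ball)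
    show "(\<Sum>k. \<integral>\<^sup>+z. ennreal (C * t k powr \<beta>) * indicator (ball (0::'a) (2 * t k)) z \<partial>lebesgue)
      = (\<Sum>k. ennreal (C * t k powr \<beta>) * emeasure lebesgue (ball (0::'a) (2 * t k)))"
      by (simp only: nn_integral_cmult_indicator[OF ball])
  qed
  also have "\<dots> = (\<Sum>k. ennreal (?V * 2 ^ ?n * C * r powr (\<beta> + real ?n) * ?x ^ k))"
    by (simp only: dyadic_term)
  also have "\<dots> = ennreal (?V * 2 ^ ?n * C * r powr (\<beta> + real ?n) * (1 / (1 - ?x)))"
  proof (rule suminf_ennreal_eq)
    show "(\<lambda>k. ?V * 2 ^ ?n * C * r powr (\<beta> + real ?n) * ?x ^ k)
        sums (?V * 2 ^ ?n * C * r powr (\<beta> + real ?n) * (1 / (1 - ?x)))"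
      by (intro sums_mult geometric_sums xx)
  qed (use pos xx in auto)
  also have "?V * 2 ^ ?n * C * r powr (\<beta> + real ?n) * (1 / (1 - ?x)) = ?B"
    by simp
  finally have nn: "(\<integral>\<^sup>+z. ennreal (f z) \<partial>lebesgue) \<le> ennreal ?B" .
  then have "(\<integral>\<^sup>+z. ennreal (f z) \<partial>lebesgue) < \<infinity>"
    by (rule le_less_trans) simp
  then show int: "integrable lebesgue f"
    using f by (intro integrableI_nonneg) auto
  have "ennreal (\<integral>z. f z \<partial>lebesgue) = (\<integral>\<^sup>+z. ennreal (f z) \<partial>lebesgue)"
    using nn_integral_eq_integral[OF int] f by simp
  with nn have "ennreal (\<integral>z. f z \<partial>lebesgue) \<le> ennreal ?B" by simp
  moreover have "0 \<le> ?B"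
    using pos ratio by (intro mult_nonneg_nonneg divide_nonneg_nonneg) auto
  ultimately show "(\<integral>z. f z \<partial>lebesgue) \<le> ?B"
    by (subst (asm) ennreal_le_iff)
qed

text \<open>Dyadic rings shrink to the origin, and the series converges because
  \<open>2 - 2 * s\<close> is positive, which is where \<open>s < 1\<close> enters. As
  \<open>A\<close> does not depend on \<open>r\<close>, a paraboloid term can be absorbed at a
  radius chosen later.\<close>

lemma frac_kernel_near:
  fixes s :: real
  assumes "0 < s" "s < 1"
  shows "\<exists>A>0. \<forall>r>0. integrable lebesgue (\<lambda>z::'a::euclidean_space. indicator (ball 0 r) z * ((norm z)\<^sup>2 * frac_kernel s z))
      \<and> (\<integral>z. indicator (ball 0 r) z * ((norm (z::'a))\<^sup>2 * frac_kernel s z) \<partial>lebesgue) \<le> A * r powr (2 - 2 * s)"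
proof -
  let ?q = "real DIM('a) + 2 * s" and ?V = "unit_ball_vol (real DIM('a))"
  let ?f = "\<lambda>r z::'a. indicator (ball 0 r) z * ((norm z)\<^sup>2 * frac_kernel s z) :: real"
  let ?A = "?V * 2 ^ DIM('a) * 4 / (1 - (1/2) powr (2 - 2 * s)) * (1/2) powr (2 - 2* s)"
  have x: "(1/2::real) powr (2 - 2 * s) < 1"
    using assms powr_less_one[of "2::real" "-(2 - 2 * s)"] by (simp add: powr_divide powr_minus_divide)
  have "?A > 0" using x by (intro mult_pos_pos divide_pos_pos) auto
  moreover have "integrable lebesgue (?f r) \<and> (\<integral>z. ?f r z \<partial>lebesgue) \<le> ?A * r powr (2 - 2* s)"
    if r: "r > 0" for r
  proof -
    have cover: "\<exists>k. norm z < 2 * (r / 2 * (1/2) ^ k) \<and> ?f r z \<le> 4 * (r / 2 * (1/2) ^ k) powr (2 - ?q)"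
      if nz: "?f r z \<noteq> 0" for z
    proof -
      have z: "0 < norm z" "norm z < r"
        using nz by (auto split: split_indicator_asm)
      obtain k0 where "(1/2::real) ^ k0 < 2 * norm z / r"
        using real_arch_pow_inv[of "2 * norm z / r" "1/2"] z r by auto
      then have ex: "\<exists>k. r / 2 * (1/2) ^ k \<le> norm z"
        using r by (intro exI[of _ k0]) (auto simp: field_simps)
      \<comment> \<open>The least index gives \<open>t \<le> norm z < 2 * t\<close> for
        \<open>t = r / 2 * (1/2) ^ k\<close>. Starting the radii at \<open>r / 2\<close> makes index
        0 the outermost ring.\<close>
      define k where "k = (LEAST k. r / 2 * (1/2) ^ k \<le> norm z)"
      have k1: "r / 2 * (1/2) ^ k \<le> norm z" unfolding k_def by (rule LeastI_ex[OF ex])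
      have k2: "norm z < 2 * (r / 2 * (1/2) ^ k)"
      proof (cases k)
        case 0 then show ?thesis using z by simp
      next
        case (Suc j)
        then have "\<not> r / 2 * (1/2) ^ j \<le> norm z"
          using not_less_Least[of j "\<lambda>k. r / 2 * (1/2) ^ k \<le> norm z"] unfolding k_def by auto
        then show ?thesis using Suc by simp
      qed
      let ?t = "r / 2 * (1/2) ^ k"
      have t: "0 < ?t" using r by simp
      have "norm z powr - ?q \<le> ?t powr - ?q"
        using k1 t assms by (intro powr_mono2') auto
      moreover have "(norm z)\<^sup>2 \<le> (2 * ?t)\<^sup>2"
        using k2 by (intro power_mono) auto
      ultimately have "(norm z)\<^sup>2 * frac_kernel s z \<le> (2 * ?t)\<^sup>2 * ?t powr - ?q"
        unfolding frac_kernel_def by (intro mult_mono) auto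
      also have "\<dots> = 4 * (?t powr 2 * ?t powr - ?q)"
        using t by (simp add: power2_eq_square)
      also have "\<dots> = 4 * ?t powr (2 - ?q)"
        by (simp add: powr_add[symmetric] algebra_simps del: powr_numeral)
      finally show ?thesis using k2 z by (intro exI[of _ k]) (auto simp: indicator_def)
    qed
    have e: "2 - ?q + real DIM('a) = 2 - 2 * s" by simp
    have "?f r \<in> borel_measurable lebesgue"
      by (intro borel_measurable_times borel_measurable_indicator) (auto intro: measurable_completion)
    note D = dyadic_integral_bound[OF this, of "r/2" "1/2" 4 "2 - ?q", unfolded e, OF _ _ _ _ x cover]
    have "(r/2) powr (2 - 2* s) = r powr (2-2* s) * (1/2) powr (2-2* s)"
      using r by (simp add: powr_divide)
    then show ?thesis using D r by (auto simp: mult_ac)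
  qed
  ultimately show ?thesis by blast
qed

text \<open>The rings now grow by the factor 2, and the series converges because
  \<open>- 2 * s\<close> is negative, which is where \<open>0 < s\<close> enters. Only finiteness is
  recorded, as no scaling in \<open>r\<close> is asked of the far part.\<close>

lemma frac_kernel_far:
  fixes s :: real
  assumes "0 < s" "0 < r"
  shows "integrable lebesgue (\<lambda>z::'a::euclidean_space. indicator (- ball 0 r) z * frac_kernel s z)"
proof (rule dyadic_integral_bound)
  let ?q = "real DIM('a) + 2 * s"
  show "(2::real) powr (- ?q + real DIM('a)) < 1"
    using assms powr_less_one[of "2::real" "- (2 * s)"] by simp
  fix z :: 'a
  assume "indicator (- ball 0 r) z * frac_kernel s z \<noteq> 0"
  then have z: "r \<le> norm z" by (auto split: split_indicator_asm)
  obtain k0 where "norm z / r < 2 ^ k0"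
    using real_arch_pow[of 2 "norm z / r"] by auto
  then have "norm z < r * 2 ^ k0"
    using assms by (simp add: field_simps)
  moreover have "0 < r * 2 ^ k0" using assms by simp
  ultimately have "norm z < 2 * (r * 2 ^ k0)" by linarith
  then have ex: "\<exists>k. norm z < 2 * (r * 2 ^ k)" by blast
  define k where "k = (LEAST k. norm z < 2 * (r * 2 ^ k))"
  have k1: "norm z < 2 * (r * 2 ^ k)" unfolding k_def by (rule LeastI_ex[OF ex])
  have k2: "r * 2 ^ k \<le> norm z"
  proof (cases k)
    case 0 then show ?thesis using z by simp
  next
    case (Suc j)
    then have "\<not> norm z < 2 * (r * 2 ^ j)"
      using not_less_Least[of j "\<lambda>k. norm z < 2 * (r * 2 ^ k)"] unfolding k_def by auto
    then show ?thesis using Suc by simp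
  qed
  have "norm z powr - ?q \<le> (r * 2 ^ k) powr - ?q"
    using k2 assms by (intro powr_mono2') auto
  then show "\<exists>k. norm z < 2 * (r * 2 ^ k) \<and>
      indicator (- ball 0 r) z * frac_kernel s z \<le> 1 * (r * 2 ^ k) powr - ?q"
    using k1 by (intro exI[of _ k]) (auto simp: frac_kernel_def split: split_indicator)
qed (use assms in \<open>auto intro!: borel_measurable_times borel_measurable_indicator frac_kernel_measurable\<close>)

section \<open>Elliptic kernels and paraboloid test functions\<close>

text \<open>What the estimates retain of the kernel in \<open>nonlocal_integrand\<close>: two-sided
  comparability with the isotropic one. The lower bound on the whole space is what lets a single
  point see all of the mass.\<close>

definition elliptic_kernel :: "real \<Rightarrow> real \<Rightarrow> real \<Rightarrow> ('a::euclidean_space \<Rightarrow> real) \<Rightarrow> bool" where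
  "elliptic_kernel s lam Lam K \<longleftrightarrow> K \<in> borel_measurable lebesgue \<and>
     (\<forall>z. lam * frac_kernel s z \<le> K z \<and> K z \<le> Lam * frac_kernel s z)"

text \<open>Sign and bound hold everywhere, not almost everywhere, so that pointwise touching
  arguments apply; solutions are first replaced by such a representative.\<close>

definition bounded_nonneg :: "('a::euclidean_space \<Rightarrow> real) \<Rightarrow> bool" where
  "bounded_nonneg u \<longleftrightarrow> u \<in> borel_measurable lebesgue \<and> (\<forall>x. 0 \<le> u x) \<and> (\<exists>B. \<forall>x. u x \<le> B)"

definition paraboloid_integrand ::
    "('a::euclidean_space \<Rightarrow> real) \<Rightarrow> ('a \<Rightarrow> real) \<Rightarrow> 'a \<Rightarrow> real \<Rightarrow> real \<Rightarrow> 'a \<Rightarrow> real" where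
  "paraboloid_integrand K u x d M z =
     (if norm z < d then M * (norm z)\<^sup>2 else (u (x + z) + u (x - z)) / 2 - u x) * K z"

text \<open>The viscosity inequalities are only ever tested with paraboloids: inside \<open>ball x d\<close> the touching
  paraboloid has symmetrized increment \<open>M * (norm z)\<^sup>2\<close>, its linear part cancelling, and outside it \<open>u\<close> is kept.\<close>

definition subsol :: "('a::euclidean_space \<Rightarrow> real) \<Rightarrow> ('a \<Rightarrow> real) \<Rightarrow> 'a set \<Rightarrow> bool" where
  "subsol K u D \<longleftrightarrow> (\<forall>x v M d. 0 < d \<longrightarrow> ball x d \<subseteq> D \<longrightarrow>
     (\<forall>y\<in>ball x d. u y \<le> u x + v \<bullet> (y - x) + M * (norm (y - x))\<^sup>2) \<longrightarrow>
     0 \<le> (\<integral>z. paraboloid_integrand K u x d M z \<partial>lebesgue))"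

definition supersol :: "('a::euclidean_space \<Rightarrow> real) \<Rightarrow> ('a \<Rightarrow> real) \<Rightarrow> 'a set \<Rightarrow> bool" where
  "supersol K u D \<longleftrightarrow> (\<forall>x v M d. 0 < d \<longrightarrow> ball x d \<subseteq> D \<longrightarrow>
     (\<forall>y\<in>ball x d. u x + v \<bullet> (y - x) - M * (norm (y - x))\<^sup>2 \<le> u y) \<longrightarrow>
     (\<integral>z. paraboloid_integrand K u x d (- M) z \<partial>lebesgue) \<le> 0)"

definition weighted_mass :: "real \<Rightarrow> ('a::euclidean_space \<Rightarrow> real) \<Rightarrow> real" where
  "weighted_mass s u = (\<integral>y. u y * tail_weight s y \<partial>lebesgue)"

lemma elliptic_kernel_bounds:
  assumes "elliptic_kernel s lam Lam K" "0 \<le> lam"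
  shows "K \<in> borel_measurable lebesgue" "lam * frac_kernel s z \<le> K z" "K z \<le> Lam * frac_kernel s z" "0 \<le> K z"
proof -
  show K: "K \<in> borel_measurable lebesgue" "lam * frac_kernel s z \<le> K z" "K z \<le> Lam * frac_kernel s z"
    using assms by (auto simp: elliptic_kernel_def)
  show "0 \<le> K z" using K(2) assms(2) frac_kernel_nonneg[of s z] by (meson mult_nonneg_nonneg order_trans)
qed

lemma bounded_nonnegD:
  assumes "bounded_nonneg u"
  shows "u \<in> borel_measurable lebesgue" "0 \<le> u x" "\<exists>B>0. \<forall>x. u x \<le> B"
proof -
  obtain B where "\<forall>x. u x \<le> B" using assms by (auto simp: bounded_nonneg_def)
  then have "\<forall>x. u x \<le> max B 1" by (simp add: le_max_iff_disj)
  then show "\<exists>B>0. \<forall>x. u x \<le> B" by (intro exI[of _ "max B 1"]) auto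
qed (use assms in \<open>auto simp: bounded_nonneg_def\<close>)

section \<open>Pointwise comparison of the kernel with the tail weight\<close>

lemma frac_kernel_ge_one:
  assumes "0 < s" "z \<noteq> 0" "norm z \<le> 1"
  shows "1 \<le> frac_kernel s z"
  using powr_mono2'[of "- (real DIM('a) + 2 * s)" "norm (z::'a::euclidean_space)" 1] assms
  by (simp add: frac_kernel_def)

lemma tail_weight_le_one:
  assumes "0 < s"
  shows "tail_weight s y \<le> 1"
  using powr_mono2'[of "- (real DIM('a) + 2 * s)" 1 "1 + norm (y::'a::euclidean_space)"] assms
  by (simp add: tail_weight_def)

lemma tail_weight_le_frac_kernel:
  fixes y z :: "'a::euclidean_space"
  assumes "0 < s" "z \<noteq> 0" "norm z \<le> 1 + norm y"
  shows "tail_weight s y \<le> frac_kernel s z"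
  using powr_mono2'[of "- (real DIM('a) + 2 * s)" "norm z" "1 + norm y"] assms
  by (simp add: tail_weight_def frac_kernel_def)

text \<open>Since \<open>r \<le> 1\<close> and \<open>r \<le> norm z\<close>, both \<open>1\<close>
  and \<open>norm z\<close> are at most \<open>norm z / r\<close>, so
  \<open>1 + norm y \<le> 2 + norm z \<le> 3 / r * norm z\<close>. It is applied to
  \<open>y = x + z\<close> and \<open>y = x - z\<close> with \<open>x\<close> in the unit
  ball.\<close>

lemma frac_kernel_le_tail_weight:
  fixes y z :: "'a::euclidean_space"
  assumes "0 < s" "0 < r" "r \<le> 1" "r \<le> norm z" "norm y \<le> 1 + norm z"
  shows "frac_kernel s z \<le> (3 / r) powr (real DIM('a) + 2 * s) * tail_weight s y"
proof -
  let ?q = "real DIM('a) + 2 * s"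
  have "1 \<le> norm z / r" "norm z \<le> norm z / r"
    using assms mult_right_mono[of r 1 "norm z"] by (auto simp: field_simps)
  moreover have "3 / r * norm z = norm z / r + norm z / r + norm z / r" by simp
  ultimately have "1 + norm y \<le> 3 / r * norm z" using assms by linarith
  then have "(3 / r * norm z) powr - ?q \<le> (1 + norm y) powr - ?q"
    using assms norm_ge_zero[of y] by (intro powr_mono2') (auto simp del: norm_ge_zero)
  then have "(3 / r) powr ?q * (3 / r * norm z) powr - ?q \<le> (3 / r) powr ?q * tail_weight s y"
    unfolding tail_weight_def by (intro mult_left_mono) auto
  moreover have "(3 / r) powr ?q * (3 / r * norm z) powr - ?q = frac_kernel s z"
  proof -
    have "(3 / r) powr ?q * (3 / r) powr - ?q = 1"
      using assms by (simp only: powr_add[symmetric]) simp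
    then show ?thesis
      using assms by (simp only: powr_mult frac_kernel_def mult.assoc[symmetric] mult_1)
  qed
  ultimately show ?thesis by simp
qed

lemma one_le_tail_weight:
  fixes y :: "'a::euclidean_space"
  assumes "0 < s" "norm y \<le> 2"
  shows "1 \<le> 3 powr (real DIM('a) + 2 * s) * tail_weight s y"
proof -
  let ?q = "real DIM('a) + 2 * s"
  have "3 powr - ?q \<le> (1 + norm y) powr - ?q"
    using assms norm_ge_zero[of y] by (intro powr_mono2') (auto simp del: norm_ge_zero)
  then have "3 powr ?q * 3 powr - ?q \<le> 3 powr ?q * tail_weight s y"
    unfolding tail_weight_def by (intro mult_left_mono) auto
  moreover have "(3::real) powr ?q * 3 powr - ?q = 1"
    by (simp only: powr_add[symmetric]) simp
  ultimately show ?thesis by (simp only:)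
qed

lemma integrable_indicator_ball:
  "integrable lebesgue (indicator (ball (x::'a::euclidean_space) r) :: 'a \<Rightarrow> real)"
  using emeasure_lborel_ball_finite[of x r] by (intro integrable_real_indicator) auto

lemma integrable_weighted:
  fixes u :: "'a::euclidean_space \<Rightarrow> real"
  assumes u: "bounded_nonneg u" and s: "0 < s"
  shows "integrable lebesgue (\<lambda>y. u y * tail_weight s y)"
proof -
  obtain B where B: "B > 0" "\<And>x. u x \<le> B" using bounded_nonnegD(3)[OF u] by blast
  have [measurable]: "u \<in> borel_measurable lebesgue" using bounded_nonnegD(1)[OF u] .
  have "integrable lebesgue (\<lambda>y::'a. B * (indicator (ball 0 1) y + indicator (- ball 0 1) y * frac_kernel s y))"
    using s by (intro integrable_mult_right Bochner_Integration.integrable_add integrable_indicator_ball frac_kernel_far) auto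
  then show ?thesis
  proof (rule Bochner_Integration.integrable_bound)
    show "(\<lambda>y. u y * tail_weight s y) \<in> borel_measurable lebesgue"
      by (intro borel_measurable_times tail_weight_measurable) fact
    have "u y * tail_weight s y \<le> B * (indicator (ball 0 1) y + indicator (- ball 0 1) y * frac_kernel s y)" for y
    proof (intro mult_mono)
      show "tail_weight s y \<le> indicator (ball 0 1) y + indicator (- ball 0 1) y * frac_kernel s y"
        using tail_weight_le_one[OF s, of y] tail_weight_le_frac_kernel[OF s, of y y]
        by (cases "y = 0"; cases "norm y < 1") (auto simp: indicator_def)
    qed (use B in auto)
    then show "AE y in lebesgue. norm (u y * tail_weight s y)
        \<le> norm (B * (indicator (ball 0 1) y + indicator (- ball 0 1) y * frac_kernel s y))"
      using bounded_nonnegD(2)[OF u] B by (intro AE_I2) (simp add: abs_mult)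
  qed
qed

lemma paraboloid_integrand_measurable:
  fixes u :: "'a::euclidean_space \<Rightarrow> real"
  assumes u: "u \<in> borel_measurable lebesgue" and K: "K \<in> borel_measurable lebesgue"
  shows "paraboloid_integrand K u x d M \<in> borel_measurable lebesgue"
proof -
  note [measurable] = borel_measurable_lebesgue_plus[OF u, of x] K
  have [measurable]: "(norm :: 'a \<Rightarrow> real) \<in> borel_measurable lebesgue"
    by (intro measurable_completion) simp
  show ?thesis unfolding paraboloid_integrand_def[abs_def] by measurable
qed

text \<open>Within \<open>d\<close> the square tames the singularity; beyond \<open>d\<close> the
  increment lies between \<open>- B\<close> and \<open>B\<close> and the kernel is integrable. Hence
  the Bochner integrals in \<open>subsol\<close> and \<open>supersol\<close> are genuine for bounded
  \<open>u\<close>, never the default value 0.\<close>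

lemma integrable_paraboloid:
  fixes u :: "'a::euclidean_space \<Rightarrow> real"
  assumes s: "0 < s" "s < 1" and K: "elliptic_kernel s lam Lam K" and lam: "0 < lam" "lam \<le> Lam"
    and u: "bounded_nonneg u" and d: "0 < d"
  shows "integrable lebesgue (paraboloid_integrand K u x d M)"
proof -
  obtain B where B: "B > 0" "\<And>x. u x \<le> B" using bounded_nonnegD(3)[OF u] by blast
  have um: "u \<in> borel_measurable lebesgue" using bounded_nonnegD(1)[OF u] .
  note Kb = elliptic_kernel_bounds[OF K less_imp_le[OF lam(1)]]
  obtain A where near: "\<And>r. r > 0 \<Longrightarrow> integrable lebesgue (\<lambda>z::'a. indicator (ball 0 r) z * ((norm z)\<^sup>2 * frac_kernel s z))"
    using frac_kernel_near[OF s, where 'a='a] by blast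
  let ?g = "\<lambda>z::'a. \<bar>M\<bar> * Lam * (indicator (ball 0 d) z * ((norm z)\<^sup>2 * frac_kernel s z))
      + B * Lam * (indicator (- ball 0 d) z * frac_kernel s z)"
  have "integrable lebesgue ?g"
    using s d by (intro integrable_mult_right Bochner_Integration.integrable_add near frac_kernel_far)
  then show ?thesis
  proof (rule Bochner_Integration.integrable_bound)
    show "paraboloid_integrand K u x d M \<in> borel_measurable lebesgue"
      by (rule paraboloid_integrand_measurable[OF um Kb(1)])
    have "norm (paraboloid_integrand K u x d M z) \<le> ?g z" for z
    proof (cases "norm z < d")
      case True
      have "\<bar>M\<bar> * (norm z)\<^sup>2 * K z \<le> \<bar>M\<bar> * (norm z)\<^sup>2 * (Lam * frac_kernel s z)"
        by (intro mult_left_mono Kb) auto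
      then show ?thesis using True Kb(4)[of z] by (simp add: paraboloid_integrand_def abs_mult mult_ac)
    next
      case False
      have "\<bar>(u (x + z) + u (x - z)) / 2 - u x\<bar> \<le> B"
        using B(2)[of "x+z"] B(2)[of "x-z"] B(2)[of x] bounded_nonnegD(2)[OF u, of "x+z"]
          bounded_nonnegD(2)[OF u, of "x-z"] bounded_nonnegD(2)[OF u, of x] by (simp add: abs_le_iff field_simps)
      then have "\<bar>(u (x + z) + u (x - z)) / 2 - u x\<bar> * K z \<le> B * (Lam * frac_kernel s z)"
        using B by (intro mult_mono Kb) auto
      then show ?thesis using False Kb(4)[of z] by (simp add: paraboloid_integrand_def abs_mult mult_ac)
    qed
    then show "AE z in lebesgue. norm (paraboloid_integrand K u x d M z) \<le> norm (?g z)"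
      by (intro AE_I2) (smt (verit) real_norm_def)
  qed
qed

text \<open>At an extremum of \<open>u\<close> plus a multiple of
  \<open>(norm (x - p))\<^sup>2\<close>, this merges the inequalities at \<open>x + z\<close> and
  \<open>x - z\<close> into one on the symmetrized increment, with the linear part gone.\<close>

lemma parallelogram_sum:
  fixes a z :: "'a::real_inner"
  shows "(norm (a + z))\<^sup>2 + (norm (a - z))\<^sup>2 = 2 * (norm a)\<^sup>2 + 2 * (norm z)\<^sup>2"
  by (simp add: power2_norm_eq_inner algebra_simps inner_commute)

section \<open>Interior estimates\<close>

lemma integral_lincomb3:
  fixes f g h :: "'a \<Rightarrow> real"
  assumes "integrable M f" "integrable M g" "integrable M h"
  shows "integrable M (\<lambda>z. a * f z + b * g z + c * h z)"
    and "(\<integral>z. a * f z + b * g z + c * h z \<partial>M) = a * (\<integral>z. f z \<partial>M) + b * (\<integral>z. g z \<partial>M) + c * (\<integral>z. h z \<partial>M)"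
  using assms by auto

lemma integral_lincomb4:
  fixes f g h k :: "'a \<Rightarrow> real"
  assumes "integrable M f" "integrable M g" "integrable M h" "integrable M k"
  shows "integrable M (\<lambda>z. a * f z + b * g z + c * h z + d * k z)"
    and "(\<integral>z. a * f z + b * g z + c * h z + d * k z \<partial>M)
      = a * (\<integral>z. f z \<partial>M) + b * (\<integral>z. g z \<partial>M) + c * (\<integral>z. h z \<partial>M) + d * (\<integral>z. k z \<partial>M)"
  using assms by auto

text \<open>At the minimum \<open>x0\<close> of \<open>u x + M * (norm (x - p))\<^sup>2\<close>, with \<open>M\<close> of order \<open>u p\<close>, a paraboloid touches \<open>u\<close> from
  below; as the kernel is positive everywhere, the supersolution inequality at \<open>x0\<close> sees the whole mass of \<open>u\<close>.\<close>

lemma weak_harnack: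
  fixes s lam Lam r :: real
  assumes s: "0 < s" "s < 1" and lam: "0 < lam" "lam \<le> Lam" and r: "0 < r" "r \<le> 1"
  shows "\<exists>C>0. \<forall>K u (p::'a::euclidean_space). elliptic_kernel s lam Lam K \<longrightarrow> bounded_nonneg u \<longrightarrow>
    norm p + r \<le> 1 \<longrightarrow> continuous_on (ball p r) u \<longrightarrow> supersol K u (ball p r) \<longrightarrow>
    weighted_mass s u \<le> C * u p"
proof -
  let ?\<rho> = "r / 2"
  let ?near = "\<lambda>z::'a. indicator (ball 0 ?\<rho>) z * ((norm z)\<^sup>2 * frac_kernel s z)"
  let ?far = "\<lambda>z::'a. indicator (- ball 0 ?\<rho>) z * frac_kernel s z"
  have near: "integrable lebesgue ?near"
    using frac_kernel_near[OF s, where 'a='a] r by auto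
  have far: "integrable lebesgue ?far" using s r by (intro frac_kernel_far) auto
  define N where "N = (\<integral>z. ?near z \<partial>lebesgue)"
  define F where "F = (\<integral>z. ?far z \<partial>lebesgue)"
  define V where "V = measure lebesgue (ball (0::'a) ?\<rho>)"
  have V: "V > 0" using r content_ball_pos[of ?\<rho> "0::'a"] by (simp add: V_def)
  have N: "N \<ge> 0" unfolding N_def by (intro Bochner_Integration.integral_nonneg) auto
  have F: "F \<ge> 0" unfolding F_def by (intro Bochner_Integration.integral_nonneg) auto
  \<comment> \<open>The summands are the three error integrals below, with
    \<open>u p + \<tau>\<close> factored out: the paraboloid within \<open>r / 2\<close>, the mass
    lost on that ball, and the value \<open>u x0\<close> against the far kernel.\<close>
  define D where "D = Lam * (16 / r\<^sup>2) * N + lam * V + Lam * F"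
  have D: "D > 0" unfolding D_def using lam V N F by (intro add_pos_nonneg add_nonneg_pos) auto
  have "weighted_mass s u \<le> D / lam * u p"
    if K: "elliptic_kernel s lam Lam K" and u: "bounded_nonneg u" and p: "norm p + r \<le> 1"
      and cont: "continuous_on (ball p r) u" and super: "supersol K u (ball p r)"
    for K u and p :: 'a
  proof -
    note Kb = elliptic_kernel_bounds[OF K less_imp_le[OF lam(1)]]
    note u0 = bounded_nonnegD(2)[OF u]
    have main: "lam * weighted_mass s u \<le> D * (u p + \<tau>)" if \<tau>: "\<tau> > 0" for \<tau>
    proof -
      \<comment> \<open>This gives \<open>M * (r/4)\<^sup>2 = u p + \<tau>\<close>, more than the
        value \<open>u p\<close> of \<open>g\<close> at the centre, so the minimum lies within
        \<open>r/4\<close> of \<open>p\<close>. The positive \<tau> keeps \<open>M\<close> positive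
        even if \<open>u p = 0\<close>.\<close>
      define M where "M = 16 * (u p + \<tau>) / r\<^sup>2"
      have M: "M > 0" using r \<tau> u0[of p] by (simp add: M_def add_nonneg_pos)
      define g where "g x = u x + M * (norm (x - p))\<^sup>2" for x
      have sub: "cball p (3/4 * r) \<subseteq> ball p r" using r by auto
      have "continuous_on (cball p (3/4 * r)) g"
        unfolding g_def using continuous_on_subset[OF cont sub] by (intro continuous_intros)
      then obtain x0 where x0: "x0 \<in> cball p (3/4 * r)" and min: "\<And>x. x \<in> cball p (3/4 * r) \<Longrightarrow> g x0 \<le> g x"
        using continuous_attains_inf[of "cball p (3/4 * r)" g] r by auto
      have gx0: "u x0 + M * (norm (x0 - p))\<^sup>2 \<le> u p" using min[of p] r by (simp add: g_def)
      have x0p: "norm (x0 - p) < r / 4"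
      proof (rule ccontr)
        assume "\<not> norm (x0 - p) < r / 4"
        then have "M * (r/4)\<^sup>2 \<le> M * (norm (x0 - p))\<^sup>2"
          using M r by (intro mult_left_mono power_mono) auto
        moreover have "M * (r/4)\<^sup>2 = u p + \<tau>" using r by (simp add: M_def power_divide)
        ultimately show False using gx0 u0[of x0] \<tau> by linarith
      qed
      have "0 \<le> M * (norm (x0 - p))\<^sup>2" using M by simp
      then have ux0: "u x0 \<le> u p" using gx0 by linarith
      have x0n: "norm x0 \<le> 1" using x0p p norm_triangle_ineq[of p "x0 - p"] r by simp
      have x0b: "x0 \<in> ball p r" using x0p r by (simp add: dist_norm norm_minus_commute)
      have "isCont u x0" using cont x0b continuous_on_eq_continuous_at[OF open_ball] by blast
      \<comment> \<open>Inside the touching radius the integrand no longer contains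
        \<open>u\<close>. Continuity bounds the missing values by \<open>u p + \<tau>\<close>, so
        their mass can be moved to the error side.\<close>
      then obtain d0 where d0: "d0 > 0" "\<And>y. dist y x0 < d0 \<Longrightarrow> dist (u y) (u x0) < \<tau>"
        using \<tau> unfolding continuous_at_eps_delta by (metis dist_commute)
      define d where "d = min d0 ?\<rho>"
      have d: "d > 0" "d \<le> ?\<rho>" using d0 r by (auto simp: d_def)
      have inball: "x0 + z \<in> cball p (3/4 * r)" "x0 - z \<in> cball p (3/4 * r)" if "norm z < ?\<rho>" for z
        using that x0p norm_triangle_ineq[of "x0 - p" z] norm_triangle_ineq4[of "x0 - p" z]
        by (auto simp: dist_norm norm_minus_commute algebra_simps)
      have touch: "u x0 + (- (2 * M) *\<^sub>R (x0 - p)) \<bullet> (y - x0) - M * (norm (y - x0))\<^sup>2 \<le> u y"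
        if "y \<in> ball x0 d" for y
      proof -
        have "g x0 \<le> g (x0 + (y - x0))"
          using that d by (intro min inball) (auto simp: dist_norm norm_minus_commute)
        moreover have "(norm (y - p))\<^sup>2 = (norm (x0 - p))\<^sup>2 + 2 * ((x0 - p) \<bullet> (y - x0)) + (norm (y - x0))\<^sup>2"
          by (simp add: power2_norm_eq_inner algebra_simps inner_commute)
        ultimately show ?thesis by (simp add: g_def algebra_simps)
      qed
      have dball: "ball x0 d \<subseteq> ball p r"
      proof
        fix y assume "y \<in> ball x0 d"
        then show "y \<in> ball p r"
          using dist_triangle[of p y x0] x0p d r by (simp add: dist_norm norm_minus_commute)
      qed
      have le0: "(\<integral>z. paraboloid_integrand K u x0 d (- M) z \<partial>lebesgue) \<le> 0"
        using super d dball touch unfolding supersol_def by blast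
      define f where "f y = u y * tail_weight s y" for y
      have f: "integrable lebesgue f" "(\<integral>y. f y \<partial>lebesgue) = weighted_mass s u"
        using integrable_weighted[OF u s(1)] by (auto simp: f_def[abs_def] weighted_mass_def)
      have f0: "0 \<le> f y" "f y \<le> u y" for y
        using u0[of y] tail_weight_le_one[OF s(1), of y] by (auto simp: f_def mult_left_le)
      \<comment> \<open>The error function for three zones: the paraboloid for
        \<open>norm z < d\<close>, minimality of \<open>g\<close> up to \<open>r / 2\<close>, and
        beyond that only the sign of \<open>u\<close> and the comparison of the kernel with the tail
        weight.\<close>
      define G where "G z = Lam * M * ?near z + lam * (u p + \<tau>) * indicator (ball 0 ?\<rho>) z + Lam * u p * ?far z" for z
      have point: "lam * ((f (x0 + z) + f (x0 - z)) / 2) - G z \<le> paraboloid_integrand K u x0 d (- M) z" for z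
      proof -
        consider "norm z < d" | "d \<le> norm z" "norm z < ?\<rho>" | "?\<rho> \<le> norm z" by linarith
        then show ?thesis
        proof cases
          case 1
          have "u (x0 + z) < u p + \<tau>" "u (x0 - z) < u p + \<tau>"
            using d0(2)[of "x0 + z"] d0(2)[of "x0 - z"] 1 ux0 by (auto simp: d_def dist_norm)
          then have "(f (x0 + z) + f (x0 - z)) / 2 \<le> u p + \<tau>"
            using f0(2)[of "x0 + z"] f0(2)[of "x0 - z"] by simp
          then have "lam * ((f (x0 + z) + f (x0 - z)) / 2) \<le> lam * (u p + \<tau>)"
            using lam by (intro mult_left_mono) auto
          moreover have "M * (norm z)\<^sup>2 * K z \<le> Lam * M * ((norm z)\<^sup>2 * frac_kernel s z)"
            using mult_left_mono[OF Kb(3)[of z], of "M * (norm z)\<^sup>2"] M by (simp add: mult_ac)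
          moreover have "G z = Lam * M * ((norm z)\<^sup>2 * frac_kernel s z) + lam * (u p + \<tau>)"
            "paraboloid_integrand K u x0 d (- M) z = - (M * (norm z)\<^sup>2 * K z)"
            using 1 d by (auto simp: paraboloid_integrand_def G_def)
          ultimately show ?thesis by linarith
        next
          case 2
          define a where "a = (u (x0 + z) + u (x0 - z)) / 2"
          \<comment> \<open>Minimality makes the increment plus \<open>M * (norm z)\<^sup>2\<close>
            nonnegative; only then may \<open>K z\<close> be replaced by its lower bound
            \<open>lam\<close>.\<close>
          have "g x0 \<le> g (x0 + z)" "g x0 \<le> g (x0 - z)" using 2 by (auto intro!: min inball)
          then have "0 \<le> a - u x0 + M * (((norm (x0 - p + z))\<^sup>2 + (norm (x0 - p - z))\<^sup>2) / 2 - (norm (x0 - p))\<^sup>2)"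
            by (simp add: g_def a_def field_simps)
          moreover have "((norm (x0 - p + z))\<^sup>2 + (norm (x0 - p - z))\<^sup>2) / 2 - (norm (x0 - p))\<^sup>2 = (norm z)\<^sup>2"
            using parallelogram_sum[of "x0 - p" z] by (simp add: field_simps)
          ultimately have pos: "0 \<le> a - u x0 + M * (norm z)\<^sup>2" by simp
          have "z \<noteq> 0" using 2 d by auto
          then have "1 \<le> frac_kernel s z" using frac_kernel_ge_one[OF s(1), of z] 2 r by auto
          then have "lam * 1 \<le> K z" using Kb(2)[of z] mult_left_mono[of 1 "frac_kernel s z" lam] lam by linarith
          then have "(a - u x0 + M * (norm z)\<^sup>2) * (lam * 1) \<le> (a - u x0 + M * (norm z)\<^sup>2) * K z"
            using pos by (intro mult_left_mono)
          moreover have "M * (norm z)\<^sup>2 * K z \<le> Lam * M * ((norm z)\<^sup>2 * frac_kernel s z)"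
            using mult_left_mono[OF Kb(3)[of z], of "M * (norm z)\<^sup>2"] M by (simp add: mult_ac)
          moreover have "lam * ((f (x0 + z) + f (x0 - z)) / 2) \<le> lam * a"
            using f0(2)[of "x0 + z"] f0(2)[of "x0 - z"] lam unfolding a_def by (intro mult_left_mono) auto
          moreover have "lam * u x0 \<le> lam * (u p + \<tau>)" using ux0 \<tau> lam by (intro mult_left_mono) auto
          moreover have "0 \<le> M * (norm z)\<^sup>2 * (lam * 1)" using lam M by simp
          moreover have "lam * a = a * (lam * 1)" "lam * u x0 = u x0 * (lam * 1)" by simp_all
          ultimately have "lam * ((f (x0 + z) + f (x0 - z)) / 2)
              - (Lam * M * ((norm z)\<^sup>2 * frac_kernel s z) + lam * (u p + \<tau>)) \<le> (a - u x0) * K z"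
            by (simp only: distrib_right left_diff_distrib)
          moreover have "G z = Lam * M * ((norm z)\<^sup>2 * frac_kernel s z) + lam * (u p + \<tau>)"
            "paraboloid_integrand K u x0 d (- M) z = (a - u x0) * K z"
            using 2 d by (auto simp: paraboloid_integrand_def G_def a_def)
          ultimately show ?thesis by linarith
        next
          case 3
          define a where "a = (u (x0 + z) + u (x0 - z)) / 2"
          have z0: "z \<noteq> 0" using 3 r by auto
          have n: "norm z \<le> 1 + norm (x0 + z)" "norm z \<le> 1 + norm (x0 - z)"
            using norm_triangle_ineq4[of "x0 + z" x0] norm_triangle_ineq4[of x0 "x0 - z"] x0n by auto
          have "f (x0 + z) \<le> u (x0 + z) * frac_kernel s z" "f (x0 - z) \<le> u (x0 - z) * frac_kernel s z"
            unfolding f_def using n z0 s u0 by (auto intro!: mult_left_mono tail_weight_le_frac_kernel)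
          then have "(f (x0 + z) + f (x0 - z)) / 2 \<le> a * frac_kernel s z" by (simp add: a_def field_simps)
          then have "lam * ((f (x0 + z) + f (x0 - z)) / 2) \<le> lam * (a * frac_kernel s z)"
            using lam by (intro mult_left_mono) auto
          also have "\<dots> = a * (lam * frac_kernel s z)" by simp
          also have "\<dots> \<le> a * K z"
            unfolding a_def using u0 by (intro mult_left_mono Kb) (auto simp: add_nonneg_nonneg)
          finally have 1: "lam * ((f (x0 + z) + f (x0 - z)) / 2) \<le> a * K z" .
          have "u x0 * K z \<le> Lam * u p * frac_kernel s z"
            using mult_mono[OF ux0 Kb(3)[of z]] u0 Kb(4)[of z] by (simp add: mult_ac)
          with 1 have "lam * ((f (x0 + z) + f (x0 - z)) / 2) - Lam * u p * frac_kernel s z \<le> (a - u x0) * K z"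
            unfolding left_diff_distrib by linarith
          moreover have "G z = Lam * u p * frac_kernel s z"
            "paraboloid_integrand K u x0 d (- M) z = (a - u x0) * K z"
            using 3 d by (auto simp: paraboloid_integrand_def G_def a_def)
          ultimately show ?thesis by linarith
        qed
      qed
      have G: "integrable lebesgue G" "(\<integral>z. G z \<partial>lebesgue) = Lam * M * N + lam * (u p + \<tau>) * V + Lam * u p * F"
        unfolding G_def N_def F_def V_def
        using integral_lincomb3[OF near integrable_indicator_ball[of 0 ?\<rho>] far, of "Lam * M" "lam * (u p + \<tau>)" "Lam * u p"]
        by simp_all
      note fa = integrable_lebesgue_average[OF f(1), of x0]
      have "lam * weighted_mass s u - (\<integral>z. G z \<partial>lebesgue)
          = (\<integral>z. lam * ((f (x0 + z) + f (x0 - z)) / 2) - G z \<partial>lebesgue)"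
        using Bochner_Integration.integral_diff[OF integrable_mult_right[OF fa(1), of lam] G(1)]
        by (simp only: integral_mult_right_zero fa(2) f(2))
      also have "\<dots> \<le> (\<integral>z. paraboloid_integrand K u x0 d (- M) z \<partial>lebesgue)"
        using point by (intro integral_mono Bochner_Integration.integrable_diff integrable_mult_right fa(1) G(1)
            integrable_paraboloid[OF s K lam u d(1)])
      also have "\<dots> \<le> 0" by (rule le0)
      finally have "lam * weighted_mass s u \<le> Lam * M * N + lam * (u p + \<tau>) * V + Lam * u p * F"
        by (simp add: G)
      also have "\<dots> \<le> Lam * M * N + lam * (u p + \<tau>) * V + Lam * (u p + \<tau>) * F"
        using lam \<tau> F by (intro add_left_mono mult_right_mono mult_left_mono) auto
      also have "\<dots> = D * (u p + \<tau>)" by (simp add: D_def M_def field_simps)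
      finally show ?thesis .
    qed
    \<comment> \<open>Dividing by \<open>D\<close> leaves exactly \<tau> as the error, which then
      tends to 0.\<close>
    have "weighted_mass s u * lam / D \<le> u p + \<tau>" if "\<tau> > 0" for \<tau>
      using main[OF that] D by (simp add: field_simps)
    then have "weighted_mass s u * lam / D \<le> u p" by (rule field_le_epsilon)
    then show ?thesis using D lam by (simp add: field_simps)
  qed
  moreover have "D / lam > 0" using D lam by simp
  ultimately show ?thesis by blast
qed

text \<open>At the maximum \<open>x0\<close> of \<open>u y * (7/8 - norm y) ^ DIM('a)\<close> the function is at most \<open>(1 + \<omega>) * u x0\<close> on a
  ball of radius comparable to the distance of \<open>x0\<close> to the sphere. A flat paraboloid then touches \<open>u\<close> from above
  near \<open>x0\<close>, and the subsolution inequality there bounds \<open>u x0\<close> times the volume of that ball by the mass.\<close>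

lemma local_boundedness:
  fixes s lam Lam :: real
  assumes s: "0 < s" "s < 1" and lam: "0 < lam" "lam \<le> Lam"
  shows "\<exists>C>0. \<forall>K (u::'a::euclidean_space \<Rightarrow> real). elliptic_kernel s lam Lam K \<longrightarrow> bounded_nonneg u \<longrightarrow>
    continuous_on (ball 0 1) u \<longrightarrow> subsol K u (ball 0 1) \<longrightarrow>
    (\<forall>x. norm x \<le> 3/4 \<longrightarrow> u x \<le> C * weighted_mass s u)"
proof -
  let ?n = "DIM('a)" and ?q = "real DIM('a) + 2 * s"
  let ?near = "\<lambda>r (z::'a). indicator (ball 0 r) z * ((norm z)\<^sup>2 * frac_kernel s z)"
  obtain A where A: "A > 0" and near: "\<And>r. r > 0 \<Longrightarrow> integrable lebesgue (?near r)"
    "\<And>r. r > 0 \<Longrightarrow> (\<integral>z. ?near r z \<partial>lebesgue) \<le> A * r powr (2 - 2 * s)"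
    using frac_kernel_near[OF s, where 'a='a] by blast
  define V where "V = unit_ball_vol (real ?n)"
  have V: "V > 0" by (simp add: V_def)
  have Vr: "measure lebesgue (ball (0::'a) r) = V * r ^ ?n" if "r \<ge> 0" for r
    using content_ball[OF that, of "0::'a"] by (simp add: V_def)
  \<comment> \<open>With the \<open>M\<close> chosen below, this \<omega> makes the bound on the
    paraboloid term exactly half of the negative term on \<open>ball 0 r\<close>, so half of the
    latter survives.\<close>
  define \<omega> where "\<omega> = lam * V / (5 * Lam * A)"
  have \<omega>: "\<omega> > 0" using lam V A by (simp add: \<omega>_def)
  \<comment> \<open>Chosen so that \<open>1 - n * \<theta> = 1 / (1 + \<omega>)\<close> in dimension
    \<open>n\<close>; the Bernoulli inequality then bounds the loss in the weight by the factor
    \<open>1 + \<omega>\<close>.\<close>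
  define \<theta> where "\<theta> = \<omega> / ((1 + \<omega>) * real ?n)"
  have n1: "real ?n \<ge> 1" using DIM_positive[where 'a='a] by (simp add: Suc_le_eq)
  have \<theta>: "0 < \<theta>" "\<theta> < 1"
  proof -
    show "0 < \<theta>" using \<omega> n1 by (simp add: \<theta>_def)
    have "\<omega> < (1 + \<omega>) * 1" by simp
    also have "\<dots> \<le> (1 + \<omega>) * real ?n" using \<omega> n1 by (intro mult_left_mono) auto
    finally show "\<theta> < 1" using \<omega> by (simp add: \<theta>_def)
  qed
  have bern: "1 \<le> (1 - \<theta>) ^ ?n * (1 + \<omega>)"
  proof -
    have "real ?n * \<theta> = \<omega> / (1 + \<omega>)" using n1 by (simp add: \<theta>_def)
    then have "1 = (1 - real ?n * \<theta>) * (1 + \<omega>)" using \<omega> by (simp add: field_simps)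
    also have "1 - real ?n * \<theta> \<le> (1 - \<theta>) ^ ?n"
      using Bernoulli_inequality[of "- \<theta>" ?n] \<theta> by simp
    finally show ?thesis using \<omega> by (simp add: mult_right_mono)
  qed
  define D where "D = 4 * Lam * 3 powr ?q / (lam * V)"
  have D: "D > 0" using lam V by (simp add: D_def)
  \<comment> \<open>The factor \<open>8 ^ n\<close> undoes the weight, which is at least
    \<open>(1/8) ^ n\<close> for \<open>norm x \<le> 3/4\<close>; the factor
    \<open>(2 / \<theta>) ^ n\<close> turns the radius \<open>r = \<theta> * d / 2\<close> back into
    \<open>d\<close>.\<close>
  define C where "C = 8 ^ ?n * (2 / \<theta>) ^ ?n * D"
  have C: "C > 0" using \<theta> D by (simp add: C_def)
  have "u x \<le> C * weighted_mass s u"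
    if K: "elliptic_kernel s lam Lam K" and u: "bounded_nonneg u"
      and cont: "continuous_on (ball 0 1) u" and sub: "subsol K u (ball 0 1)" and x: "norm x \<le> 3/4"
    for K u and x :: 'a
  proof -
    note Kb = elliptic_kernel_bounds[OF K less_imp_le[OF lam(1)]]
    note u0 = bounded_nonnegD(2)[OF u]
    have I: "weighted_mass s u \<ge> 0"
      unfolding weighted_mass_def using u0 by (intro Bochner_Integration.integral_nonneg) auto
    define h where "h y = u y * (7/8 - norm y) ^ ?n" for y
    have contR: "continuous_on (cball 0 (7/8)) u"
      by (rule continuous_on_subset[OF cont]) auto
    have "continuous_on (cball 0 (7/8)) h" unfolding h_def by (intro continuous_intros contR)
    then obtain x0 where x0: "norm x0 \<le> 7/8" and max: "\<And>y. norm y \<le> 7/8 \<Longrightarrow> h y \<le> h x0"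
      using continuous_attains_sup[of "cball 0 (7/8)" h] by auto
    have hx: "u x * (1/8) ^ ?n \<le> h x0"
    proof -
      have "u x * (1/8) ^ ?n \<le> h x" unfolding h_def using x u0 by (intro mult_left_mono power_mono) auto
      then show ?thesis using max[of x] x by simp
    qed
    define m where "m = u x0"
    define d where "d = 7/8 - norm x0"
    have h0: "h x0 = m * d ^ ?n" by (simp add: h_def m_def d_def)
    have m0: "m \<ge> 0" "d \<ge> 0" using u0 x0 by (auto simp: m_def d_def)
    have "m * d ^ ?n \<le> (2 / \<theta>) ^ ?n * D * weighted_mass s u"
    proof (cases "m * d ^ ?n = 0")
      case True
      show ?thesis unfolding True using \<theta> D I by simp
    next
      case False
      have m: "m > 0" and d: "d > 0" using False m0 by (auto simp: less_le)
      \<comment> \<open>Within \<open>2 * r = \<theta> * d\<close> of \<open>x0\<close> the distance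
        to the sphere of radius 7/8 shrinks at most by the factor
        \<open>1 - \<theta>\<close>.\<close>
      define r where "r = \<theta> * d / 2"
      have r: "r > 0" using \<theta> d by (simp add: r_def)
      have rd: "2 * r \<le> d" using \<theta> d by (simp add: r_def mult_left_le_one_le)
      have "d \<le> 7/8" by (simp add: d_def)
      then have r1: "r \<le> 1" using rd by simp
      have inR: "norm y \<le> 7/8" if "y \<in> cball x0 (2 * r)" for y
        using that rd norm_triangle_ineq[of x0 "y - x0"] by (simp add: dist_norm norm_minus_commute d_def)
      have ub: "u y \<le> m * (1 + \<omega>)" if y: "y \<in> cball x0 (2 * r)" for y
      proof -
        have "(1 - \<theta>) * d = d - 2 * r" by (simp add: r_def algebra_simps)
        moreover have "norm y \<le> norm x0 + 2 * r"
          using y norm_triangle_ineq[of x0 "y - x0"] by (simp add: dist_norm norm_minus_commute)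
        ultimately have "(1 - \<theta>) * d \<le> 7/8 - norm y" by (simp add: d_def)
        then have "u y * ((1 - \<theta>) * d) ^ ?n \<le> h y"
          unfolding h_def using \<theta> d u0 by (intro mult_left_mono power_mono) auto
        also have "\<dots> \<le> m * d ^ ?n" using max inR[OF y] h0 by simp
        finally have "u y * (1 - \<theta>) ^ ?n \<le> m" using d by (simp add: power_mult_distrib)
        then have "u y * (1 - \<theta>) ^ ?n * (1 + \<omega>) \<le> m * (1 + \<omega>)" using \<omega> by (intro mult_right_mono) auto
        moreover have "u y * 1 \<le> u y * ((1 - \<theta>) ^ ?n * (1 + \<omega>))" using bern u0 by (intro mult_left_mono) auto
        ultimately show ?thesis by (simp add: mult.assoc)
      qed
      \<comment> \<open>Here \<open>M * r\<^sup>2\<close> is \<open>5/4 * \<omega> * m\<close>, more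
        than the largest possible rise \<open>\<omega> * m\<close> of \<open>u\<close> above
        \<open>m\<close>, so the maximum of \<open>j\<close> stays within \<open>r\<close> of
        \<open>x0\<close>.\<close>
      define M where "M = 5 * \<omega> * m / (4 * r\<^sup>2)"
      have M: "M > 0" using \<omega> m r by (simp add: M_def)
      define j where "j y = u y - M * (norm (y - x0))\<^sup>2" for y
      have "continuous_on (cball x0 (2 * r)) u"
      proof (rule continuous_on_subset[OF contR], rule subsetI)
      show "y \<in> cball 0 (7/8)" if "y \<in> cball x0 (2 * r)" for y using inR[OF that] by simp
    qed
      then have "continuous_on (cball x0 (2 * r)) j" unfolding j_def by (intro continuous_intros)
      then obtain x1 where x1: "x1 \<in> cball x0 (2 * r)" and jmax: "\<And>y. y \<in> cball x0 (2 * r) \<Longrightarrow> j y \<le> j x1"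
        using continuous_attains_sup[of "cball x0 (2 * r)" j] r by auto
      have jx1: "m + M * (norm (x1 - x0))\<^sup>2 \<le> u x1" using jmax[of x0] r by (simp add: j_def m_def)
      then have mu: "m \<le> u x1" using M by (smt (verit) mult_nonneg_nonneg zero_le_power2)
      have x1r: "norm (x1 - x0) < r"
      proof (rule ccontr)
        assume "\<not> norm (x1 - x0) < r"
        then have "M * r\<^sup>2 \<le> M * (norm (x1 - x0))\<^sup>2" using M r by (intro mult_left_mono power_mono) auto
        moreover have "M * r\<^sup>2 = 5/4 * (\<omega> * m)" using r by (simp add: M_def)
        moreover have "\<omega> * m > 0" using \<omega> m by simp
        ultimately show False using jx1 ub[OF x1] by (simp add: algebra_simps)
      qed
      have x1n: "norm x1 \<le> 1" using inR[OF x1] by simp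
      have near_x1: "x1 + z \<in> cball x0 (2 * r)" "x1 - z \<in> cball x0 (2 * r)" if "norm z < r" for z
        using that x1r norm_triangle_ineq[of "x1 - x0" z] norm_triangle_ineq4[of "x1 - x0" z]
        by (auto simp: dist_norm norm_minus_commute algebra_simps)
      have "isCont u x1" using cont inR[OF x1] continuous_on_eq_continuous_at[OF open_ball] by force
      then obtain d0 where d0: "d0 > 0" "\<And>y. dist y x1 < d0 \<Longrightarrow> dist (u y) (u x1) < m / 2"
        using m unfolding continuous_at_eps_delta by (metis half_gt_zero dist_commute)
      define dd where "dd = min d0 r"
      have dd: "dd > 0" "dd \<le> r" using d0 r by (auto simp: dd_def)
      have dball: "ball x1 dd \<subseteq> ball 0 1"
      proof
        fix y assume "y \<in> ball x1 dd"
        then have "norm y \<le> 7/8"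
          using inR[of y] near_x1(1)[of "y - x1"] dd by (simp add: dist_norm norm_minus_commute)
        then show "y \<in> ball 0 1" by simp
      qed
      have touch: "u y \<le> u x1 + ((2 * M) *\<^sub>R (x1 - x0)) \<bullet> (y - x1) + M * (norm (y - x1))\<^sup>2"
        if "y \<in> ball x1 dd" for y
      proof -
        have "j (x1 + (y - x1)) \<le> j x1"
          using that dd by (intro jmax near_x1) (auto simp: dist_norm norm_minus_commute)
        moreover have "(norm (y - x0))\<^sup>2 = (norm (x1 - x0))\<^sup>2 + 2 * ((x1 - x0) \<bullet> (y - x1)) + (norm (y - x1))\<^sup>2"
          by (simp add: power2_norm_eq_inner algebra_simps inner_commute)
        ultimately show ?thesis by (simp add: j_def algebra_simps)
      qed
      have ge0: "0 \<le> (\<integral>z. paraboloid_integrand K u x1 dd M z \<partial>lebesgue)"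
        using sub dd dball touch unfolding subsol_def by blast
      define f where "f y = u y * tail_weight s y" for y
      have f: "integrable lebesgue f" "(\<integral>y. f y \<partial>lebesgue) = weighted_mass s u"
        using integrable_weighted[OF u s(1)] by (auto simp: f_def[abs_def] weighted_mass_def)
      have f0: "0 \<le> f y" for y using u0[of y] by (simp add: f_def)
      define av where "av z = (f (x1 + z) + f (x1 - z)) / 2" for z
      note av = integrable_lebesgue_average[OF f(1), of x1, folded av_def]
      have av0: "0 \<le> av z" for z using f0 by (simp add: av_def add_nonneg_nonneg)
      \<comment> \<open>\<open>P\<close> bounds the kernel by the tail weight beyond
        \<open>r\<close>, and \<open>H\<close> bounds \<open>K\<close> from below within
        \<open>r\<close>. Both scale like \<open>r powr - (n + 2 * s)\<close>, so this power cancels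
        at the end and only \<open>r ^ n\<close> remains.\<close>
      define P where "P = (3 / r) powr ?q"
      define H where "H = lam * r powr - ?q"
      have P: "P = 3 powr ?q * r powr - ?q"
      proof -
        have "(3 / r) powr ?q = 3 powr ?q / r powr ?q" by (rule powr_divide)
        then show ?thesis unfolding P_def powr_minus_divide by (simp only: times_divide_eq_right mult_1_right)
      qed
      have H: "H > 0" using lam r by (simp add: H_def)
      have point: "paraboloid_integrand K u x1 dd M z
          \<le> Lam * M * ?near r z + Lam * P * av z + (- (H * (m / 2))) * indicator (ball 0 r) z" for z
      proof -
        define a where "a = (u (x1 + z) + u (x1 - z)) / 2"
        have a0: "a \<ge> 0" using u0 by (simp add: a_def add_nonneg_nonneg)
        have Ha: "H * a \<le> Lam * P * av z" if z: "norm z < r"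
        proof -
          have nn: "norm (x1 + z) \<le> 2" "norm (x1 - z) \<le> 2"
            using inR[OF near_x1(1)[OF z]] inR[OF near_x1(2)[OF z]] by auto
          have "u y \<le> 3 powr ?q * f y" if "norm y \<le> 2" for y
            using mult_left_mono[OF one_le_tail_weight[OF s(1) that] u0[of y]] by (simp add: f_def mult_ac)
          then have "u (x1 + z) + u (x1 - z) \<le> 3 powr ?q * f (x1 + z) + 3 powr ?q * f (x1 - z)"
            using nn by (intro add_mono) auto
          then have "a \<le> 3 powr ?q * av z" unfolding a_def av_def by (simp add: field_simps)
          then have "lam * (r powr - ?q * a) \<le> lam * (r powr - ?q * (3 powr ?q * av z))"
            using lam by (intro mult_left_mono) auto
          also have "\<dots> \<le> Lam * (r powr - ?q * (3 powr ?q * av z))"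
            using lam av0[of z] by (intro mult_right_mono) auto
          finally show ?thesis by (simp add: H_def P mult_ac)
        qed
        consider "norm z < dd" | "dd \<le> norm z" "norm z < r" | "r \<le> norm z" by linarith
        then show ?thesis
        proof cases
          case 1
          \<comment> \<open>The paraboloid supplies no negative term here. Since the average
            \<open>a\<close> is at least \<open>m / 2\<close>, the mass term alone already exceeds
            \<open>H * (m / 2)\<close>, which may therefore be subtracted on all of
            \<open>ball 0 r\<close>.\<close>
          have "\<bar>u (x1 + z) - u x1\<bar> < m / 2" "\<bar>u (x1 - z) - u x1\<bar> < m / 2"
            using d0(2)[of "x1 + z"] d0(2)[of "x1 - z"] 1 unfolding dd_def by (simp_all add: dist_norm)
          then have "u x1 - m / 2 < u (x1 + z)" "u x1 - m / 2 < u (x1 - z)" by linarith+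
          then have "m / 2 \<le> a" using mu by (simp add: a_def)
          then have "H * (m / 2) \<le> H * a" using H by (intro mult_left_mono) auto
          moreover have "M * (norm z)\<^sup>2 * K z \<le> Lam * M * ((norm z)\<^sup>2 * frac_kernel s z)"
            using mult_left_mono[OF Kb(3)[of z], of "M * (norm z)\<^sup>2"] M by (simp add: mult_ac)
          moreover have "paraboloid_integrand K u x1 dd M z = M * (norm z)\<^sup>2 * K z"
            using 1 by (simp add: paraboloid_integrand_def)
          moreover have "z \<in> ball 0 r" using 1 dd by simp
          ultimately show ?thesis using Ha 1 dd by simp
        next
          case 2
          \<comment> \<open>By maximality the increment minus \<open>M * (norm z)\<^sup>2\<close> is
            nonpositive, so replacing \<open>K z\<close> by the smaller \<open>H\<close> can only
            increase the product.\<close>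
          have "j (x1 + z) \<le> j x1" "j (x1 - z) \<le> j x1" using 2 by (auto intro!: jmax near_x1)
          then have "a - u x1 - M * (((norm (x1 - x0 + z))\<^sup>2 + (norm (x1 - x0 - z))\<^sup>2) / 2 - (norm (x1 - x0))\<^sup>2) \<le> 0"
            by (simp add: j_def a_def field_simps)
          moreover have "((norm (x1 - x0 + z))\<^sup>2 + (norm (x1 - x0 - z))\<^sup>2) / 2 - (norm (x1 - x0))\<^sup>2 = (norm z)\<^sup>2"
            using parallelogram_sum[of "x1 - x0" z] by (simp add: field_simps)
          ultimately have neg: "a - u x1 - M * (norm z)\<^sup>2 \<le> 0" by simp
          have "r powr - ?q \<le> frac_kernel s z"
            unfolding frac_kernel_def using 2 dd s by (intro powr_mono2') auto
          then have "H \<le> lam * frac_kernel s z" unfolding H_def using lam by (intro mult_left_mono) auto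
          then have "H \<le> K z" using Kb(2)[of z] by simp
          then have "(a - u x1 - M * (norm z)\<^sup>2) * K z \<le> (a - u x1 - M * (norm z)\<^sup>2) * H"
            using neg by (intro mult_left_mono_neg) auto
          moreover have "M * (norm z)\<^sup>2 * K z \<le> Lam * M * ((norm z)\<^sup>2 * frac_kernel s z)"
            using mult_left_mono[OF Kb(3)[of z], of "M * (norm z)\<^sup>2"] M by (simp add: mult_ac)
          moreover have "0 \<le> M * (norm z)\<^sup>2 * H" using M H by simp
          moreover have "H * (m / 2) \<le> u x1 * H" using mult_right_mono[of "m/2" "u x1" H] mu m H by (simp add: mult_ac)
          moreover have "a * H \<le> Lam * P * av z" using Ha 2 by (simp add: mult.commute)
          ultimately have "(a - u x1) * K z
              \<le> Lam * M * ((norm z)\<^sup>2 * frac_kernel s z) + Lam * P * av z - H * (m / 2)"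
            unfolding left_diff_distrib by linarith
          then show ?thesis using 2 by (simp add: paraboloid_integrand_def a_def)
        next
          case 3
          have n: "norm (x1 + z) \<le> 1 + norm z" "norm (x1 - z) \<le> 1 + norm z"
            using norm_triangle_ineq[of x1 z] norm_triangle_ineq4[of x1 z] x1n by auto
          have "u (x1 + z) * frac_kernel s z \<le> P * f (x1 + z)" "u (x1 - z) * frac_kernel s z \<le> P * f (x1 - z)"
            using mult_left_mono[OF frac_kernel_le_tail_weight[OF s(1) r r1 3 n(1)] u0[of "x1 + z"]]
              mult_left_mono[OF frac_kernel_le_tail_weight[OF s(1) r r1 3 n(2)] u0[of "x1 - z"]]
            by (simp_all add: f_def P_def mult_ac)
          then have "a * frac_kernel s z \<le> P * av z" by (simp add: a_def av_def field_simps)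
          then have 1: "Lam * (a * frac_kernel s z) \<le> Lam * (P * av z)" using lam by (intro mult_left_mono) auto
          have "(a - u x1) * K z \<le> a * K z" using u0 Kb by (intro mult_right_mono) auto
          also have "\<dots> \<le> a * (Lam * frac_kernel s z)" using a0 by (intro mult_left_mono Kb)
          also have "\<dots> \<le> Lam * P * av z" using 1 by (simp add: mult_ac)
          finally show ?thesis using 3 dd by (simp add: paraboloid_integrand_def a_def)
        qed
      qed
      note comb = integral_lincomb3[OF near(1)[OF r] av(1) integrable_indicator_ball[of 0 r],
          of "Lam * M" "Lam * P" "- (H * (m / 2))"]
      have "0 \<le> (\<integral>z. Lam * M * ?near r z + Lam * P * av z + (- (H * (m / 2))) * indicator (ball 0 r) z \<partial>lebesgue)"
        by (rule order_trans[OF ge0]) (intro integral_mono integrable_paraboloid[OF s K lam u dd(1)] comb(1) point)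
      also have "\<dots> = Lam * M * (\<integral>z. ?near r z \<partial>lebesgue) + Lam * P * weighted_mass s u - H * (m / 2) * (V * r ^ ?n)"
        unfolding comb(2) using Vr[of r] r by (simp add: av(2) f(2))
      also have "\<dots> \<le> Lam * M * (A * r powr (2 - 2 * s)) + Lam * P * weighted_mass s u - H * (m / 2) * (V * r ^ ?n)"
        using near(2)[OF r] lam M by (intro add_right_mono diff_right_mono mult_left_mono) auto
      also have "Lam * M * (A * r powr (2 - 2 * s)) = r powr - ?q * (lam * V * m * r ^ ?n / 4)"
      proof -
        have "r powr (2 - 2 * s) = r powr (- ?q + real ?n + 2)" by simp
        also have "\<dots> = r powr - ?q * r ^ ?n * r\<^sup>2"
          unfolding powr_add using r by (simp add: powr_realpow)
        finally have "Lam * M * (A * r powr (2 - 2 * s)) = Lam * A * (M * r\<^sup>2) * (r powr - ?q * r ^ ?n)" by simp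
        also have "M * r\<^sup>2 = 5/4 * \<omega> * m" using r by (simp add: M_def)
        also have "Lam * A * (5/4 * \<omega> * m) = lam * V * m / 4"
          using lam A by (simp add: \<omega>_def field_simps)
        finally show ?thesis by simp
      qed
      finally have "0 \<le> r powr - ?q * (lam * V * m * r ^ ?n / 4 + Lam * 3 powr ?q * weighted_mass s u
           - lam * V * m * r ^ ?n / 2)"
        by (simp add: P H_def algebra_simps)
      then have "lam * V * (m * r ^ ?n) \<le> 4 * Lam * 3 powr ?q * weighted_mass s u"
        using r by (simp add: zero_le_mult_iff mult_ac)
      then have "m * r ^ ?n \<le> D * weighted_mass s u"
        using lam V by (simp add: D_def field_simps)
      then have "(2 / \<theta>) ^ ?n * (m * r ^ ?n) \<le> (2 / \<theta>) ^ ?n * (D * weighted_mass s u)"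
        using \<theta> by (intro mult_left_mono) auto
      moreover have "(2 / \<theta>) ^ ?n * (m * r ^ ?n) = m * d ^ ?n"
        using \<theta> by (simp add: r_def power_mult_distrib power_divide)
      ultimately show ?thesis by (simp only: mult.assoc)
    qed
    then have "8 ^ ?n * (u x * (1/8) ^ ?n) \<le> 8 ^ ?n * ((2 / \<theta>) ^ ?n * D * weighted_mass s u)"
      using hx h0 by (intro mult_left_mono) auto
    then show ?thesis by (simp add: C_def power_divide mult_ac)
  qed
  with C show ?thesis by blast
qed

section \<open>Boundary comparison\<close>

text \<open>Doubling of variables. If \<open>u1 p > C * u2 p\<close>, then at a maximum \<open>(x, y)\<close> of
  \<open>u1 x - C1 * (norm (x - p))\<^sup>2 - C * u2 y - E * (norm (x - y))\<^sup>2\<close> paraboloids touch \<open>u1\<close> from above at \<open>x\<close> and \<open>u2\<close> from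
  below at \<open>y\<close>. In the difference of the two inequalities \<open>E\<close> enters only through the integral over the ball of
  radius \<open>d\<close>, which vanishes as \<open>d\<close> tends to \<open>0\<close>, whereas the values of \<open>C * u2\<close> on \<open>ball q r\<close> give a negative
  contribution proportional to \<open>C\<close>.\<close>

lemma boundary_comparison:
  fixes s lam Lam r b c :: real
  assumes s: "0 < s" "s < 1" and lam: "0 < lam" "lam \<le> Lam" and r: "0 < r" "r \<le> 1/16"
    and b: "0 < b" and c: "0 < c"
  shows "\<exists>C>0. \<forall>K (u1::'a::euclidean_space \<Rightarrow> real) u2 \<Omega> q. elliptic_kernel s lam Lam K \<longrightarrow>
    bounded_nonneg u1 \<longrightarrow> bounded_nonneg u2 \<longrightarrow> continuous_on (ball 0 1) u1 \<longrightarrow> continuous_on (ball 0 1) u2 \<longrightarrow>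
    open \<Omega> \<longrightarrow> (\<forall>x\<in>ball 0 1 - \<Omega>. u1 x = 0) \<longrightarrow>
    subsol K u1 (ball 0 1) \<longrightarrow> supersol K u2 (ball 0 1 \<inter> \<Omega>) \<longrightarrow>
    (\<forall>x. norm x \<le> 3/4 \<longrightarrow> u1 x \<le> b) \<longrightarrow> weighted_mass s u1 \<le> b \<longrightarrow>
    ball q (2 * r) \<subseteq> ball 0 1 \<longrightarrow> (\<forall>x\<in>ball q (2 * r). c \<le> u2 x) \<longrightarrow>
    (\<forall>p\<in>ball 0 (1/2). u1 p \<le> C * u2 p)"
proof -
  let ?e = "real DIM('a) + 2 * s"
  let ?near = "\<lambda>r (z::'a). indicator (ball 0 r) z * ((norm z)\<^sup>2 * frac_kernel s z)"
  obtain A where A: "A > 0" and near: "\<And>r. r > 0 \<Longrightarrow> integrable lebesgue (?near r)"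
    "\<And>r. r > 0 \<Longrightarrow> (\<integral>z. ?near r z \<partial>lebesgue) \<le> A * r powr (2 - 2 * s)"
    using frac_kernel_near[OF s, where 'a='a] by blast
  define N where "N = (\<integral>z. ?near r z \<partial>lebesgue)"
  have N: "N \<ge> 0" unfolding N_def by (intro Bochner_Integration.integral_nonneg) auto
  define V where "V = unit_ball_vol (real DIM('a)) * r ^ DIM('a)"
  have V: "V > 0" using r by (simp add: V_def)
  have Vr: "measure lebesgue (ball (x::'a) r) = V" for x
    using content_ball[of r x] r by (simp add: V_def)
  define \<kappa> where "\<kappa> = (2::real) powr - ?e"
  have \<kappa>: "\<kappa> > 0" by (simp add: \<kappa>_def)
  define P where "P = (3 / r) powr ?e"
  have P: "P \<ge> 0" by (simp add: P_def)
  \<comment> \<open>Then \<open>C1 * (1/8)\<^sup>2 = 2 * b\<close> exceeds every value of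
    \<open>u1\<close> on the ball of radius 3/4, which confines \<open>x\<close> to distance 1/8
    from \<open>p\<close>.\<close>
  define C1 where "C1 = 128 * b"
  \<comment> \<open>The error terms free of \<open>E\<close>; the spare 1 pays for the term with
    \<open>E\<close>, which is made at most 1/2.\<close>
  define Q where "Q = C1 * Lam * N + Lam * P * b + 1"
  have Q: "Q > 0" unfolding Q_def C1_def using lam N P b by (intro add_nonneg_pos add_nonneg_nonneg) auto
  \<comment> \<open>The first summand lets the gain from \<open>ball q r\<close> reach
    \<open>Q\<close>; the second gives \<open>b < C * c\<close>, which keeps \<open>y\<close> out of
    \<open>ball q (2 * r)\<close>.\<close>
  define C where "C = 2 * Q / (c * lam * \<kappa> * V) + 2 * b / c"
  have C0: "2 * Q / (c * lam * \<kappa> * V) > 0" "2 * b / c > 0" using Q c lam \<kappa> V b by auto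
  then have C: "C > 0" by (simp add: C_def)
  have Cc: "b < C * c"
  proof -
    have "C * c = 2 * Q / (c * lam * \<kappa> * V) * c + 2 * b" using c by (simp add: C_def field_simps)
    moreover have "0 \<le> 2 * Q / (c * lam * \<kappa> * V) * c" using C0(1) c by (intro mult_nonneg_nonneg) auto
    ultimately show ?thesis using b by linarith
  qed
  have CQ: "Q \<le> C * c / 2 * lam * \<kappa> * V"
  proof -
    have "Q = 2 * Q / (c * lam * \<kappa> * V) * (c / 2 * lam * \<kappa> * V)" using c lam \<kappa> V by simp
    also have "\<dots> \<le> C * (c / 2 * lam * \<kappa> * V)"
      using C0 c lam \<kappa> V by (intro mult_right_mono) (auto simp: C_def)
    finally show ?thesis by simp
  qed
  have main: "u1 p \<le> C * u2 p"
    if K: "elliptic_kernel s lam Lam K" and u1: "bounded_nonneg u1" and u2: "bounded_nonneg u2"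
      and cont: "continuous_on (ball 0 1) u1" "continuous_on (ball 0 1) u2"
      and \<Omega>: "open \<Omega>" and out: "\<And>x. x \<in> ball 0 1 - \<Omega> \<Longrightarrow> u1 x = 0"
      and sub: "subsol K u1 (ball 0 1)" and super: "supersol K u2 (ball 0 1 \<inter> \<Omega>)"
      and ub: "\<And>x. norm x \<le> 3/4 \<Longrightarrow> u1 x \<le> b" and mass: "weighted_mass s u1 \<le> b"
      and qb: "ball q (2 * r) \<subseteq> ball 0 1" and lb: "\<And>x. x \<in> ball q (2 * r) \<Longrightarrow> c \<le> u2 x"
      and p: "p \<in> ball 0 (1/2)"
    for K u1 u2 \<Omega> and q p :: 'a
  proof (rule ccontr)
    assume "\<not> u1 p \<le> C * u2 p"
    define m where "m = u1 p - C * u2 p"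
    have m: "m > 0" using \<open>\<not> _\<close> by (simp add: m_def)
    have pn: "norm p < 1/2" using p by simp
    note Kb = elliptic_kernel_bounds[OF K less_imp_le[OF lam(1)]]
    note u10 = bounded_nonnegD(2)[OF u1] and u20 = bounded_nonnegD(2)[OF u2]
    have C1: "C1 > 0" using b by (simp add: C1_def)
    have contB: "continuous_on (cball 0 (3/4)) u1" "continuous_on (cball 0 (3/4)) u2"
      by (rule continuous_on_subset[OF cont(1)], force, rule continuous_on_subset[OF cont(2)], force)
    obtain \<gamma> where \<gamma>: "\<gamma> > 0" "\<And>x y. x \<in> cball 0 (3/4) \<Longrightarrow> y \<in> cball 0 (3/4) \<Longrightarrow> dist y x < \<gamma> \<Longrightarrow> dist (u1 y) (u1 x) < m"
      using compact_uniformly_continuous[OF contB(1) compact_cball] m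
      unfolding uniformly_continuous_on_def by metis
    \<comment> \<open>Taking \<open>r\<close> into the minimum gives \<open>norm y < 11/16\<close>,
      so \<open>y + z\<close> and \<open>y - z\<close> stay in the ball of radius 3/4 for
      \<open>norm z < r\<close>.\<close>
    define \<eta> where "\<eta> = min \<gamma> r"
    have \<eta>: "\<eta> > 0" using \<gamma> r by (simp add: \<eta>_def)
    define E where "E = 2 * b / \<eta>\<^sup>2"
    have E: "E > 0" using b \<eta> by (simp add: E_def)
    define \<Psi> where "\<Psi> w = u1 (fst w) - C1 * (norm (fst w - p))\<^sup>2 - C * u2 (snd w) - E * (norm (fst w - snd w))\<^sup>2" for w
    have "continuous_on (cball 0 (3/4) \<times> cball 0 (3/4)) \<Psi>"
      unfolding \<Psi>_def
      by (intro continuous_intros continuous_on_compose2[OF contB(1)] continuous_on_compose2[OF contB(2)]) auto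
    then obtain w where w: "w \<in> cball 0 (3/4) \<times> cball 0 (3/4)"
      "\<And>w'. w' \<in> cball 0 (3/4) \<times> cball 0 (3/4) \<Longrightarrow> \<Psi> w' \<le> \<Psi> w"
      using continuous_attains_sup[of "cball 0 (3/4) \<times> cball 0 (3/4)" \<Psi>] by (auto simp: compact_Times)
    obtain x y where wxy: "w = (x, y)" by fastforce
    have xy: "norm x \<le> 3/4" "norm y \<le> 3/4" using w(1) wxy by auto
    have max: "u1 x' - C1 * (norm (x' - p))\<^sup>2 - C * u2 y' - E * (norm (x' - y'))\<^sup>2
        \<le> u1 x - C1 * (norm (x - p))\<^sup>2 - C * u2 y - E * (norm (x - y))\<^sup>2"
      if "norm x' \<le> 3/4" "norm y' \<le> 3/4" for x' y'
      using w(2)[of "(x', y')"] that by (simp add: \<Psi>_def wxy)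
    have nonneg: "0 \<le> C1 * (norm (x - p))\<^sup>2" "0 \<le> C * u2 y" "0 \<le> E * (norm (x - y))\<^sup>2"
      using C1 C E u20 by auto
    \<comment> \<open>Comparison with the diagonal point \<open>(p, p)\<close>, where both penalties
      vanish.\<close>
    have base: "m + C1 * (norm (x - p))\<^sup>2 + C * u2 y + E * (norm (x - y))\<^sup>2 \<le> u1 x"
      using max[of p p] pn by (simp add: m_def)
    have ux: "u1 x \<le> b" using ub xy by simp
    have xy\<eta>: "norm (x - y) < \<eta>"
    proof (rule ccontr)
      assume "\<not> norm (x - y) < \<eta>"
      then have "E * \<eta>\<^sup>2 \<le> E * (norm (x - y))\<^sup>2" using E \<eta> by (intro mult_left_mono power_mono) auto
      moreover have "E * \<eta>\<^sup>2 = 2 * b" using \<eta> by (simp add: E_def)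
      ultimately show False using base nonneg ux m b by linarith
    qed
    have xp: "norm (x - p) < 1/8"
    proof (rule ccontr)
      assume "\<not> norm (x - p) < 1/8"
      then have "C1 * (1/8)\<^sup>2 \<le> C1 * (norm (x - p))\<^sup>2" using C1 by (intro mult_left_mono power_mono) auto
      moreover have "C1 * (1/8)\<^sup>2 = 2 * b" by (simp add: C1_def power2_eq_square)
      ultimately show False using base nonneg ux m b by linarith
    qed
    have xn: "norm x < 5/8" using norm_triangle_ineq[of p "x - p"] xp pn by simp
    have yn: "norm y < 11/16"
      using norm_triangle_ineq4[of x "x - y"] xn xy\<eta> r by (simp add: \<eta>_def)
    \<comment> \<open>\<open>E\<close> was chosen through the uniform continuity of \<open>u1\<close> so that \<open>u1 y > 0\<close>, which keeps \<open>y\<close> away from the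
      boundary of \<open>\<Omega>\<close>.\<close>
    have y\<Omega>: "y \<in> \<Omega>"
    proof (rule ccontr)
      assume "y \<notin> \<Omega>"
      then have "u1 y = 0" using out[of y] yn by simp
      moreover have "dist (u1 y) (u1 x) < m"
        using \<gamma>(2)[of x y] xy xy\<eta> by (simp add: \<eta>_def dist_norm norm_minus_commute)
      ultimately show False using base nonneg by (simp add: dist_norm)
    qed
    have yq: "y \<notin> ball q (2 * r)"
    proof
      assume "y \<in> ball q (2 * r)"
      then have "C * c \<le> C * u2 y" using lb C by (intro mult_left_mono) auto
      then show False using Cc base nonneg ux m by linarith
    qed
    define X where "X = Lam * (C1 + 2 * E) * A"
    have X: "X > 0" using lam C1 E A by (simp add: X_def)
    \<comment> \<open>Solves \<open>X * d1 powr (2 - 2 * s) = 1/2\<close>. \<open>X\<close> contains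
      \<open>E\<close>, but nothing fixed earlier depends on \<open>d\<close>.\<close>
    define d1 where "d1 = (1 / (2 * X)) powr (1 / (2 - 2 * s))"
    have d1: "d1 > 0" using X by (simp add: d1_def)
    obtain d2 where d2: "d2 > 0" "ball y d2 \<subseteq> \<Omega>" using \<Omega> y\<Omega> openE by blast
    define d where "d = min r (min d1 d2)"
    have d: "d > 0" "d \<le> r" "d \<le> d1" "d \<le> d2" using r d1 d2 by (auto simp: d_def)
    have dX: "X * d powr (2 - 2 * s) \<le> 1/2"
    proof -
      have "d powr (2 - 2 * s) \<le> d1 powr (2 - 2 * s)" using d s by (intro powr_mono2) auto
      also have "\<dots> = 1 / (2 * X)" using X s by (simp add: d1_def powr_powr)
      finally have "X * d powr (2 - 2 * s) \<le> X * (1 / (2 * X))" using X by (intro mult_left_mono) auto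
      then show ?thesis using X by simp
    qed
    have xz: "norm (x + z) \<le> 3/4" "norm (x - z) \<le> 3/4" "norm (y + z) \<le> 3/4" "norm (y - z) \<le> 3/4"
      if "norm z < r" for z
      using that r xn yn norm_triangle_ineq[of x z] norm_triangle_ineq4[of x z]
        norm_triangle_ineq[of y z] norm_triangle_ineq4[of y z] by auto
    have shift: "x' = x + (x' - x)" "norm (x' - x) < r" if "x' \<in> ball x d" for x x' :: 'a
      using that d by (auto simp: dist_norm norm_minus_commute)
    have sq: "(norm (b - a))\<^sup>2 = (norm (x - a))\<^sup>2 + 2 * ((x - a) \<bullet> (b - x)) + (norm (b - x))\<^sup>2" for a b x :: 'a
      by (simp add: power2_norm_eq_inner algebra_simps inner_commute)
    \<comment> \<open>Freezing \<open>y\<close> turns maximality into touching of \<open>u1\<close>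
      at \<open>x\<close>; freezing \<open>x\<close> does the same for \<open>u2\<close> at
      \<open>y\<close>, after division by \<open>- C\<close>. The opening \<open>E / C\<close> there
      becomes \<open>E\<close> again when \<open>C * T2\<close> is subtracted.\<close>
    have touch1: "u1 x' \<le> u1 x + ((2 * C1) *\<^sub>R (x - p) + (2 * E) *\<^sub>R (x - y)) \<bullet> (x' - x) + (C1 + E) * (norm (x' - x))\<^sup>2"
      if x': "x' \<in> ball x d" for x'
      using max[of x' y] xy xz(1)[of "x' - x"] shift[OF x'] sq[of x' p x] sq[of x' y x]
      by (simp add: inner_add_left algebra_simps)
    have touch2: "u2 y + ((2 * E / C) *\<^sub>R (x - y)) \<bullet> (y' - y) - E / C * (norm (y' - y))\<^sup>2 \<le> u2 y'"
      if y': "y' \<in> ball y d" for y'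
    proof -
      have "- C * u2 y' - E * (norm (x - y'))\<^sup>2 \<le> - C * u2 y - E * (norm (x - y))\<^sup>2"
        using max[of x y'] xy xz(3)[of "y' - y"] shift[OF y'] by simp
      moreover have "(norm (x - y'))\<^sup>2 = (norm (x - y))\<^sup>2 - 2 * ((x - y) \<bullet> (y' - y)) + (norm (y' - y))\<^sup>2"
        by (simp add: power2_norm_eq_inner algebra_simps inner_commute)
      ultimately have "C * u2 y + 2 * E * ((x - y) \<bullet> (y' - y)) - E * (norm (y' - y))\<^sup>2 \<le> C * u2 y'"
        by (simp add: algebra_simps)
      then have "(C * u2 y + 2 * E * ((x - y) \<bullet> (y' - y)) - E * (norm (y' - y))\<^sup>2) / C \<le> u2 y'"
        using C by (simp add: field_simps)
      then show ?thesis using C by (simp add: add_divide_distrib diff_divide_distrib)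
    qed
    have dball: "ball x d \<subseteq> ball 0 1" "ball y d \<subseteq> ball 0 1 \<inter> \<Omega>"
    proof -
      show "ball x d \<subseteq> ball 0 1"
      proof
        fix x' assume "x' \<in> ball x d"
        then show "x' \<in> ball 0 1" using xz(1)[of "x' - x"] shift[of x' x] by simp
      qed
      show "ball y d \<subseteq> ball 0 1 \<inter> \<Omega>"
      proof
        fix y' assume y': "y' \<in> ball y d"
        then have "y' \<in> \<Omega>" using d d2 by (meson subset_ball subset_iff)
        then show "y' \<in> ball 0 1 \<inter> \<Omega>" using xz(3)[of "y' - y"] shift[OF y'] by simp
      qed
    qed
    define T1 where "T1 = paraboloid_integrand K u1 x d (C1 + E)"
    define T2 where "T2 = paraboloid_integrand K u2 y d (- (E / C))"
    have T: "integrable lebesgue T1" "integrable lebesgue T2"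
      unfolding T1_def T2_def by (intro integrable_paraboloid[OF s K lam] u1 u2 d(1))+
    have T1: "0 \<le> (\<integral>z. T1 z \<partial>lebesgue)"
      using sub d(1) dball(1) touch1 unfolding subsol_def T1_def by blast
    have T2: "(\<integral>z. T2 z \<partial>lebesgue) \<le> 0"
      using super d(1) dball(2) touch2 unfolding supersol_def T2_def by blast
    define f where "f y = u1 y * tail_weight s y" for y
    have f: "integrable lebesgue f" "(\<integral>y. f y \<partial>lebesgue) = weighted_mass s u1"
      using integrable_weighted[OF u1 s(1)] by (auto simp: f_def[abs_def] weighted_mass_def)
    have f0: "0 \<le> f y" for y using u10[of y] by (simp add: f_def)
    define av where "av z = (f (x + z) + f (x - z)) / 2" for z
    note av = integrable_lebesgue_average[OF f(1), of x, folded av_def]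
    have av0: "0 \<le> av z" for z using f0 by (simp add: av_def add_nonneg_nonneg)
    define H where "H = C * c / 2 * lam * \<kappa>"
    have H0: "H > 0" using C c lam \<kappa> by (simp add: H_def)
    define G where "G z = Lam * (C1 + 2 * E) * ?near d z + C1 * Lam * ?near r z + Lam * P * av z
        + (- H) * indicator (ball (q - y) r) z" for z
    have point: "T1 z - C * T2 z \<le> G z" for z
    proof -
      define k2 where "k2 = (norm z)\<^sup>2 * frac_kernel s z"
      have k2: "k2 \<ge> 0" by (simp add: k2_def)
      have PA: "0 \<le> Lam * P * av z" using lam P av0 by simp
      have ind0: "z \<notin> ball (q - y) r" if "norm z < r"
      proof
        assume "z \<in> ball (q - y) r"
        then have "norm (q - y) < 2 * r"
          using that norm_triangle_ineq[of "q - y - z" z] by (simp add: dist_norm)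
        then show False using yq by (simp add: dist_norm)
      qed
      consider "norm z < d" | "d \<le> norm z" "norm z < r" | "r \<le> norm z" by linarith
      then show ?thesis
      proof cases
        case 1
        then have zr: "norm z < r" using d by simp
        have "T1 z - C * T2 z = (C1 + 2 * E) * (norm z)\<^sup>2 * K z"
          using 1 C by (simp add: T1_def T2_def paraboloid_integrand_def field_simps)
        also have "\<dots> \<le> (C1 + 2 * E) * (norm z)\<^sup>2 * (Lam * frac_kernel s z)"
          using C1 E by (intro mult_left_mono Kb) auto
        finally have "T1 z - C * T2 z \<le> Lam * (C1 + 2 * E) * k2" by (simp add: k2_def mult_ac)
        moreover have "0 \<le> C1 * Lam * k2" using C1 lam k2 by simp
        moreover have "G z = Lam * (C1 + 2 * E) * k2 + C1 * Lam * k2 + Lam * P * av z"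
          using 1 zr ind0[OF zr] by (simp add: G_def k2_def)
        ultimately show ?thesis using PA by linarith
      next
        case 2
        define S where "S = ((u1 (x + z) + u1 (x - z)) / 2 - u1 x) - C * ((u2 (y + z) + u2 (y - z)) / 2 - u2 y)"
        \<comment> \<open>Both points move by the same \<open>z\<close>, so
          \<open>norm (x - y)\<close> is unchanged and \<open>E\<close> cancels. This is why
          \<open>E\<close> survives only for \<open>norm z < d\<close>.\<close>
        have "u1 (x + z) - C1 * (norm (x - p + z))\<^sup>2 - C * u2 (y + z) \<le> u1 x - C1 * (norm (x - p))\<^sup>2 - C * u2 y"
          using max[of "x + z" "y + z"] xz[OF 2(2)] by (simp add: algebra_simps)
        moreover have "u1 (x - z) - C1 * (norm (x - p - z))\<^sup>2 - C * u2 (y - z) \<le> u1 x - C1 * (norm (x - p))\<^sup>2 - C * u2 y"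
          using max[of "x - z" "y - z"] xz[OF 2(2)] by (simp add: algebra_simps)
        ultimately have "S \<le> C1 * (((norm (x - p + z))\<^sup>2 + (norm (x - p - z))\<^sup>2) / 2 - (norm (x - p))\<^sup>2)"
          by (simp add: S_def field_simps)
        moreover have "((norm (x - p + z))\<^sup>2 + (norm (x - p - z))\<^sup>2) / 2 - (norm (x - p))\<^sup>2 = (norm z)\<^sup>2"
          using parallelogram_sum[of "x - p" z] by (simp add: field_simps)
        ultimately have S: "S \<le> C1 * (norm z)\<^sup>2" by simp
        have "T1 z - C * T2 z = S * K z"
          using 2 by (simp add: T1_def T2_def paraboloid_integrand_def S_def algebra_simps)
        also have "\<dots> \<le> C1 * (norm z)\<^sup>2 * K z" using S Kb by (intro mult_right_mono) auto
        also have "\<dots> \<le> C1 * (norm z)\<^sup>2 * (Lam * frac_kernel s z)" using C1 by (intro mult_left_mono Kb) auto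
        finally have "T1 z - C * T2 z \<le> C1 * Lam * k2" by (simp add: k2_def mult_ac)
        moreover have "G z = C1 * Lam * k2 + Lam * P * av z"
          using 2 ind0 by (simp add: G_def k2_def)
        ultimately show ?thesis using PA by linarith
      next
        case 3
        define a1 where "a1 = (u1 (x + z) + u1 (x - z)) / 2"
        define a2 where "a2 = (u2 (y + z) + u2 (y - z)) / 2"
        have a: "a1 \<ge> 0" "a2 \<ge> 0" using u10 u20 by (auto simp: a1_def a2_def add_nonneg_nonneg)
        have n: "norm (x + z) \<le> 1 + norm z" "norm (x - z) \<le> 1 + norm z"
          using norm_triangle_ineq[of x z] norm_triangle_ineq4[of x z] xn by auto
        have r1: "r \<le> 1" using r by simp
        have "u1 (x + z) * frac_kernel s z \<le> P * f (x + z)" "u1 (x - z) * frac_kernel s z \<le> P * f (x - z)"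
          using mult_left_mono[OF frac_kernel_le_tail_weight[OF s(1) r(1) r1 3 n(1)] u10[of "x + z"]]
            mult_left_mono[OF frac_kernel_le_tail_weight[OF s(1) r(1) r1 3 n(2)] u10[of "x - z"]]
          by (simp_all add: f_def P_def mult_ac)
        then have "a1 * frac_kernel s z \<le> P * av z" by (simp add: a1_def av_def field_simps)
        then have 1: "Lam * (a1 * frac_kernel s z) \<le> Lam * (P * av z)" using lam by (intro mult_left_mono) auto
        have "a1 * K z \<le> a1 * (Lam * frac_kernel s z)" using a by (intro mult_left_mono Kb)
        also have "\<dots> \<le> Lam * P * av z" using 1 by (simp add: mult_ac)
        finally have A1: "a1 * K z \<le> Lam * P * av z" .
        \<comment> \<open>One of the two shifts suffices: \<open>y + z\<close> in
          \<open>ball q (2 * r)\<close> contributes \<open>c\<close> and \<open>y - z\<close> at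
          least 0, hence the \<open>c / 2\<close> in \<open>H\<close>.\<close>
        have A2: "H * indicator (ball (q - y) r) z \<le> C * a2 * K z"
        proof (cases "z \<in> ball (q - y) r")
          case True
          then have yz: "y + z \<in> ball q (2 * r)" using r by (simp add: dist_norm algebra_simps)
          then have "c / 2 \<le> a2" using lb[OF yz] u20[of "y - z"] by (simp add: a2_def)
          moreover have "norm z \<le> 2"
            using subsetD[OF qb yz] yn norm_triangle_ineq4[of "y + z" y] by simp
          then have "\<kappa> \<le> frac_kernel s z"
            unfolding \<kappa>_def frac_kernel_def using 3 r s by (intro powr_mono2') auto
          then have "lam * \<kappa> \<le> lam * frac_kernel s z" using lam by (intro mult_left_mono) auto
          then have "lam * \<kappa> \<le> K z" using Kb(2)[of z] by simp
          ultimately have "C * (c / 2) * (lam * \<kappa>) \<le> C * a2 * K z"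
            using C a lam \<kappa> by (intro mult_mono mult_left_mono) auto
          then show ?thesis using True by (simp add: H_def mult_ac)
        next
          case False
          then show ?thesis using C a Kb(4)[of z] by simp
        qed
        have "(C * u2 y - u1 x) * K z \<le> 0"
          using base nonneg m Kb(4)[of z] by (intro mult_nonpos_nonneg) auto
        moreover have "T1 z - C * T2 z = a1 * K z - C * a2 * K z + (C * u2 y - u1 x) * K z"
          using 3 d by (simp add: T1_def T2_def paraboloid_integrand_def a1_def a2_def algebra_simps)
        moreover have "G z = Lam * P * av z - H * indicator (ball (q - y) r) z"
          using 3 d by (simp add: G_def)
        ultimately show ?thesis using A1 A2 by linarith
      qed
    qed
    note comb = integral_lincomb4[OF near(1)[OF d(1)] near(1)[OF r(1)] av(1) integrable_indicator_ball[of "q - y" r],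
        of "Lam * (C1 + 2 * E)" "C1 * Lam" "Lam * P" "- H", folded G_def]
    have "C * (\<integral>z. T2 z \<partial>lebesgue) \<le> 0" using C T2 by (simp add: mult_nonneg_nonpos)
    then have "0 \<le> (\<integral>z. T1 z \<partial>lebesgue) - C * (\<integral>z. T2 z \<partial>lebesgue)" using T1 by linarith
    also have "\<dots> = (\<integral>z. T1 z - C * T2 z \<partial>lebesgue)" using T by simp
    also have "\<dots> \<le> (\<integral>z. G z \<partial>lebesgue)"
      using T by (intro integral_mono Bochner_Integration.integrable_diff integrable_mult_right comb(1) point)
    also have "\<dots> = Lam * (C1 + 2 * E) * (\<integral>z. ?near d z \<partial>lebesgue) + C1 * Lam * N
        + Lam * P * weighted_mass s u1 - H * V"
      unfolding comb(2) by (simp add: av(2) f(2) N_def Vr)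
    also have "\<dots> \<le> Lam * (C1 + 2 * E) * (A * d powr (2 - 2 * s)) + C1 * Lam * N + Lam * P * b - H * V"
      using near(2)[OF d(1)] mass lam C1 E P by (intro add_mono diff_right_mono mult_left_mono order_refl) auto
    also have "\<dots> = X * d powr (2 - 2 * s) + (Q - 1) - H * V" by (simp add: X_def Q_def)
    also have "\<dots> < 0" using dX CQ by (simp add: H_def)
    finally show False by simp
  qed
  show ?thesis
    by (intro exI[of _ C] conjI allI impI ballI, rule C, rule main) (assumption | blast)+
qed

section \<open>From viscosity solutions to paraboloid tests\<close>

text \<open>In \<Omega>, shrink the ball until the hypothesis applies; returning to the larger ball
  replaces increments of \<open>u\<close> by the larger \<open>M * (norm z)\<^sup>2\<close>. Off
  \<Omega>, \<open>u\<close> attains its minimum 0, so \<open>M\<close> is nonnegative and so is the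
  whole integrand.\<close>

lemma subsol_extend_by_zero:
  fixes u :: "'a::euclidean_space \<Rightarrow> real"
  assumes s: "0 < s" "s < 1" and K: "elliptic_kernel s lam Lam K" and lam: "0 < lam" "lam \<le> Lam"
    and u: "bounded_nonneg u" and \<Omega>: "open \<Omega>" and out: "\<And>x. x \<in> D - \<Omega> \<Longrightarrow> u x = 0"
    and sub: "subsol K u (D \<inter> \<Omega>)"
  shows "subsol K u D"
  unfolding subsol_def
proof (intro allI impI)
  fix x v :: 'a and M d :: real
  assume d: "0 < d" and dD: "ball x d \<subseteq> D"
    and touch: "\<forall>y\<in>ball x d. u y \<le> u x + v \<bullet> (y - x) + M * (norm (y - x))\<^sup>2"
  note u0 = bounded_nonnegD(2)[OF u]
  note K0 = elliptic_kernel_bounds(4)[OF K less_imp_le[OF lam(1)]]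
  have avg: "(u (x + z) + u (x - z)) / 2 - u x \<le> M * (norm z)\<^sup>2" if "norm z < d" for z
    using bspec[OF touch, of "x + z"] bspec[OF touch, of "x - z"] that by (simp add: dist_norm field_simps)
  show "0 \<le> (\<integral>z. paraboloid_integrand K u x d M z \<partial>lebesgue)"
  proof (cases "x \<in> \<Omega>")
    case True
    then obtain e where e: "e > 0" "ball x e \<subseteq> \<Omega>" using \<Omega> openE by blast
    define d' where "d' = min d e"
    have d': "d' > 0" "d' \<le> d" using d e by (auto simp: d'_def)
    have d'sub: "ball x d' \<subseteq> D \<inter> \<Omega>" using dD e by (auto simp: d'_def)
    have "\<forall>y\<in>ball x d'. u y \<le> u x + v \<bullet> (y - x) + M * (norm (y - x))\<^sup>2" using touch d' by auto
    then have "0 \<le> (\<integral>z. paraboloid_integrand K u x d' M z \<partial>lebesgue)"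
      using sub d'(1) d'sub unfolding subsol_def by blast
    also have "\<dots> \<le> (\<integral>z. paraboloid_integrand K u x d M z \<partial>lebesgue)"
    proof (intro integral_mono integrable_paraboloid[OF s K lam u] d d'(1))
      show "paraboloid_integrand K u x d' M z \<le> paraboloid_integrand K u x d M z" for z
        unfolding paraboloid_integrand_def using avg[of z] d' K0 by (intro mult_right_mono) auto
    qed
    finally show ?thesis .
  next
    case False
    have "u x = 0" using out[of x] dD d False by (meson DiffI centre_in_ball subsetD)
    obtain z :: 'a where z: "norm z = d / 2" using vector_choose_size[of "d / 2"] d by auto
    have "norm z < d" using z d by simp
    moreover have "0 \<le> (u (x + z) + u (x - z)) / 2 - u x"
      using u0[of "x + z"] u0[of "x - z"] \<open>u x = 0\<close> by simp
    ultimately have "0 \<le> M * (norm z)\<^sup>2" using avg order_trans by blast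
    then have "M \<ge> 0" using z d by (simp add: zero_le_mult_iff)
    then show ?thesis
      unfolding paraboloid_integrand_def using \<open>u x = 0\<close> u0 K0
      by (intro Bochner_Integration.integral_nonneg mult_nonneg_nonneg) (auto simp: add_nonneg_nonneg)
  qed
qed

lemma C2_on_paraboloid: "C2_on N (\<lambda>y::'a::euclidean_space. c + v \<bullet> (y - x) + M * (norm (y - x))\<^sup>2)"
  unfolding C2_on_def
proof (intro exI conjI ballI)
  fix y :: 'a
  show "GDERIV (\<lambda>y. c + v \<bullet> (y - x) + M * (norm (y - x))\<^sup>2) y :> v + (2 * M) *\<^sub>R (y - x)"
    unfolding gderiv_def power2_norm_eq_inner
    by (auto intro!: derivative_eq_intros simp: inner_add_right inner_commute algebra_simps)
  show "((\<lambda>y. v + (2 * M) *\<^sub>R (y - x)) has_derivative blinfun_apply ((2 * M) *\<^sub>R id_blinfun)) (at y)"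
    by (auto intro!: derivative_eq_intros simp: blinfun.scaleR_left)
qed (rule continuous_on_const)

lemma elliptic_kernel_sphere:
  fixes a :: "'a::euclidean_space \<Rightarrow> real"
  assumes a: "(\<lambda>y. a (y /\<^sub>R norm y)) \<in> borel_measurable lebesgue"
    and bd: "\<And>\<theta>. \<theta> \<in> sphere 0 1 \<Longrightarrow> lam \<le> a \<theta> \<and> a \<theta> \<le> Lam"
  shows "elliptic_kernel s lam Lam (\<lambda>y. a (y /\<^sub>R norm y) / norm y powr (real DIM('a) + 2 * s))"
proof -
  have "(\<lambda>y::'a. norm y powr (real DIM('a) + 2 * s)) \<in> borel_measurable lebesgue"
    by (intro measurable_completion) measurable
  then have "(\<lambda>y. a (y /\<^sub>R norm y) / norm y powr (real DIM('a) + 2 * s)) \<in> borel_measurable lebesgue"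
    using a by (intro borel_measurable_divide)
  moreover have "a (z /\<^sub>R norm z) / norm z powr (real DIM('a) + 2 * s) = a (z /\<^sub>R norm z) * frac_kernel s z" for z
    by (simp only: frac_kernel_def powr_minus_divide) simp
  moreover have "lam * frac_kernel s z \<le> a (z /\<^sub>R norm z) * frac_kernel s z
      \<and> a (z /\<^sub>R norm z) * frac_kernel s z \<le> Lam * frac_kernel s z" for z
  proof (cases "z = 0")
    \<comment> \<open>Here \<open>0 powr y = 0\<close>, so all three kernels vanish at the origin,
      where \<open>a\<close> is evaluated off the sphere.\<close>
    case True
    then show ?thesis by (simp add: frac_kernel_def)
  next
    case False
    then show ?thesis using bd[of "z /\<^sub>R norm z"] by (auto intro!: mult_right_mono)
  qed
  ultimately show ?thesis by (simp add: elliptic_kernel_def)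
qed

text \<open>Truncation changes \<open>u\<close> only on a null set. Within \<open>S\<close> the
  changed points lie in an open set by continuity, and an open null set is empty, so
  \<open>u\<close> is unchanged at every point of \<open>S\<close>.\<close>

lemma bounded_nonneg_representative:
  fixes u :: "'a::euclidean_space \<Rightarrow> real"
  assumes u: "u \<in> L_infty" and nonneg: "AE x in lebesgue. 0 \<le> u x"
    and S: "open S" and cont: "continuous_on S u"
  obtains w where "bounded_nonneg w" "\<And>x. x \<in> S \<Longrightarrow> w x = u x" "AE x in lebesgue. w x = u x"
proof -
  obtain B where um: "u \<in> borel_measurable lebesgue" and B: "AE x in lebesgue. \<bar>u x\<bar> \<le> B"
    using u by (auto simp: L_infty_def)
  define w where "w x = max 0 (min (u x) \<bar>B\<bar>)" for x
  have AE: "AE x in lebesgue. 0 \<le> u x \<and> u x \<le> \<bar>B\<bar>" using nonneg B by eventually_elim auto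
  show thesis
  proof
    have "w \<in> borel_measurable lebesgue" unfolding w_def using um by measurable
    then show "bounded_nonneg w" unfolding bounded_nonneg_def
      by (auto simp: w_def intro!: exI[of _ "\<bar>B\<bar>"])
    show "AE x in lebesgue. w x = u x" using AE by eventually_elim (auto simp: w_def)
    fix x assume x: "x \<in> S"
    define C where "C = - (S \<inter> u -` (- {0..\<bar>B\<bar>}))"
    have "open (- {0..\<bar>B\<bar>})" by (simp add: open_Compl)
    then have "closed C"
      unfolding C_def by (intro closed_Compl continuous_open_preimage cont S)
    moreover have "AE x \<in> S in lebesgue. x \<in> C" using AE by eventually_elim (auto simp: C_def)
    ultimately have "x \<in> C" using mem_closed_if_AE_lebesgue_open[OF S] x by blast
    then show "w x = u x" using x by (auto simp: C_def w_def)
  qed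
qed

text \<open>The linear part of the test function cancels in the symmetrized increment. The shifts
  preserve null sets, so passing from \<open>u\<close> to \<open>w\<close> does not affect the
  integral, and integrability makes the extended real value finite.\<close>

lemma nonlocal_op_paraboloid:
  fixes u w :: "'a::euclidean_space \<Rightarrow> real"
  defines "K a s y \<equiv> a (y /\<^sub>R norm y) / norm y powr (real DIM('a) + 2 * s)"
  assumes s: "0 < s" "s < 1" and K: "elliptic_kernel s lam Lam (K a s)" and lam: "0 < lam" "lam \<le> Lam"
    and um: "u \<in> borel_measurable lebesgue" and w: "bounded_nonneg w"
    and wu: "AE x in lebesgue. w x = u x" "w x = u x" and d: "0 < d"
  shows "nonlocal_op s a (\<lambda>y. if y \<in> ball x d then u x + v \<bullet> (y - x) + M * (norm (y - x))\<^sup>2 else u y) x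
    = ereal (\<integral>z. paraboloid_integrand (K a s) w x d M z \<partial>lebesgue)"
proof -
  let ?g = "\<lambda>y. if y \<in> ball x d then u x + v \<bullet> (y - x) + M * (norm (y - x))\<^sup>2 else u y"
  have eq: "nonlocal_integrand s a ?g x = paraboloid_integrand (K a s) u x d M"
    using d by (auto simp: fun_eq_iff nonlocal_integrand_def paraboloid_integrand_def K_def dist_norm add_divide_distrib diff_divide_distrib)
  note meas = paraboloid_integrand_measurable[OF _ elliptic_kernel_bounds(1)[OF K less_imp_le[OF lam(1)]]]
  have "AE z in lebesgue. w (x + z) = u (x + z)" "AE z in lebesgue. w (x - z) = u (x - z)"
    using AE_lebesgue_plus[OF wu(1), of x] by auto
  then have ae: "AE z in lebesgue. paraboloid_integrand (K a s) w x d M z = paraboloid_integrand (K a s) u x d M z"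
    by eventually_elim (simp add: paraboloid_integrand_def wu(2))
  have "integrable lebesgue (paraboloid_integrand (K a s) w x d M)"
    by (rule integrable_paraboloid[OF s K lam w d])
  then have "integrable lebesgue (nonlocal_integrand s a ?g x)"
    unfolding eq using integrable_cong_AE[OF meas meas ae] um bounded_nonnegD(1)[OF w] by blast
  then have "nonlocal_op s a ?g x = ereal (\<integral>z. paraboloid_integrand (K a s) u x d M z \<partial>lebesgue)"
    by (simp only: nonlocal_op_eq_integral eq)
  also have "(\<integral>z. paraboloid_integrand (K a s) u x d M z \<partial>lebesgue)
      = (\<integral>z. paraboloid_integrand (K a s) w x d M z \<partial>lebesgue)"
    using integral_cong_AE[OF meas meas ae] um bounded_nonnegD(1)[OF w] by simp
  finally show ?thesis .
qed

text \<open>The neighbourhood in the viscosity test is \<open>ball x d\<close> and the test function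
  is the paraboloid itself; touching passes from \<open>w\<close> to \<open>u\<close> because they
  agree at every point of \<open>D\<close>.\<close>

lemma visc_imp_subsol_supersol:
  fixes u w :: "'a::euclidean_space \<Rightarrow> real"
  defines "K a s y \<equiv> a (y /\<^sub>R norm y) / norm y powr (real DIM('a) + 2 * s)"
  assumes s: "0 < s" "s < 1" and K: "elliptic_kernel s lam Lam (K a s)" and lam: "0 < lam" "lam \<le> Lam"
    and um: "u \<in> borel_measurable lebesgue" and w: "bounded_nonneg w"
    and wu: "AE x in lebesgue. w x = u x" "\<And>x. x \<in> D \<Longrightarrow> w x = u x"
    and visc: "visc_eq (nonlocal_op s a) u (\<lambda>x. 0) D"
  shows "subsol (K a s) w D" "supersol (K a s) w D"
proof -
  note op = nonlocal_op_paraboloid[OF s K[unfolded K_def] lam um w wu(1), folded K_def]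
  show "subsol (K a s) w D"
    unfolding subsol_def
  proof (intro allI impI)
    fix x v :: 'a and M d :: real
    assume d: "0 < d" and dD: "ball x d \<subseteq> D"
      and touch: "\<forall>y\<in>ball x d. w y \<le> w x + v \<bullet> (y - x) + M * (norm (y - x))\<^sup>2"
    have xD: "x \<in> D" using dD d by (meson centre_in_ball subsetD)
    have "\<forall>y\<in>ball x d. u y \<le> u x + v \<bullet> (y - x) + M * (norm (y - x))\<^sup>2"
      using touch dD xD wu(2) by (metis subset_iff)
    then have "ereal 0 \<le> nonlocal_op s a (\<lambda>y. if y \<in> ball x d then u x + v \<bullet> (y - x) + M * (norm (y - x))\<^sup>2 else u y) x"
      using visc[unfolded visc_eq_def visc_ge_def, THEN conjunct1, rule_format, OF xD open_ball centre_in_ball[THEN iffD2, OF d] dD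
          C2_on_paraboloid[of _ "u x" v x M]]
      by simp
    then show "0 \<le> (\<integral>z. paraboloid_integrand (K a s) w x d M z \<partial>lebesgue)"
      unfolding op[OF wu(2)[OF xD] d] by simp
  qed
  show "supersol (K a s) w D"
    unfolding supersol_def
  proof (intro allI impI)
    fix x v :: 'a and M d :: real
    assume d: "0 < d" and dD: "ball x d \<subseteq> D"
      and touch: "\<forall>y\<in>ball x d. w x + v \<bullet> (y - x) - M * (norm (y - x))\<^sup>2 \<le> w y"
    have xD: "x \<in> D" using dD d by (meson centre_in_ball subsetD)
    have "\<forall>y\<in>ball x d. u x + v \<bullet> (y - x) + - M * (norm (y - x))\<^sup>2 \<le> u y"
      using touch dD xD wu(2) by (simp add: subset_iff)
    then have "nonlocal_op s a (\<lambda>y. if y \<in> ball x d then u x + v \<bullet> (y - x) + - M * (norm (y - x))\<^sup>2 else u y) x \<le> ereal 0"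
      using visc[unfolded visc_eq_def visc_le_def, THEN conjunct2, rule_format, OF xD open_ball centre_in_ball[THEN iffD2, OF d] dD
          C2_on_paraboloid[of _ "u x" v x "- M"]]
      by simp
    then show "(\<integral>z. paraboloid_integrand (K a s) w x d (- M) z \<partial>lebesgue) \<le> 0"
      unfolding op[OF wu(2)[OF xD] d] by simp
  qed
qed

section \<open>The boundary Harnack principle\<close>

lemma supersol_subset:
  assumes "supersol K u D" "E \<subseteq> D"
  shows "supersol K u E"
  using assms unfolding supersol_def by (meson order_trans)

text \<open>Local boundedness and supremum 1 give mass at least \<open>1 / B\<close>; the weak
  Harnack inequality at \<open>q\<close>, with \<open>w q \<le> 1\<close>, gives mass at most
  \<open>A\<close>. Harnack at points of \<open>ball q (2 * r)\<close> then yields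
  \<open>1 / (A * B)\<close>; the radius \<open>4 * r\<close> leaves room for a ball around each of
  them.\<close>

lemma normalized_bounds:
  fixes s lam Lam r :: real and \<Omega> :: "'a::euclidean_space set"
  assumes s: "0 < s" "s < 1" and lam: "0 < lam" "lam \<le> Lam" and r: "0 < r" "r \<le> 1/16"
    and q: "ball q (4 * r) \<subseteq> \<Omega> \<inter> ball 0 (1/2)"
  shows "\<exists>b>0. \<exists>c>0. \<forall>K w. elliptic_kernel s lam Lam K \<longrightarrow> bounded_nonneg w \<longrightarrow>
    continuous_on (ball 0 1) w \<longrightarrow> subsol K w (ball 0 1) \<longrightarrow> supersol K w (ball 0 1 \<inter> \<Omega>) \<longrightarrow>
    (SUP x\<in>ball 0 (1/2). w x) = 1 \<longrightarrow>
    0 < weighted_mass s w \<and> weighted_mass s w \<le> b \<and> (\<forall>x. norm x \<le> 3/4 \<longrightarrow> w x \<le> b) \<and>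
    (\<forall>x\<in>ball q (2 * r). c \<le> w x)"
proof -
  have r2: "0 < 2 * r" "2 * r \<le> 1" using r by auto
  obtain A where A: "A > 0" and harnack: "\<forall>K u (p::'a). elliptic_kernel s lam Lam K \<longrightarrow> bounded_nonneg u \<longrightarrow>
      norm p + 2 * r \<le> 1 \<longrightarrow> continuous_on (ball p (2 * r)) u \<longrightarrow> supersol K u (ball p (2 * r)) \<longrightarrow>
      weighted_mass s u \<le> A * u p"
    using weak_harnack[OF s lam r2, where 'a='a] by (elim exE conjE) (rule that)
  obtain B where B: "B > 0" and bounded: "\<forall>K (u::'a \<Rightarrow> real). elliptic_kernel s lam Lam K \<longrightarrow> bounded_nonneg u \<longrightarrow>
      continuous_on (ball 0 1) u \<longrightarrow> subsol K u (ball 0 1) \<longrightarrow>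
      (\<forall>x. norm x \<le> 3/4 \<longrightarrow> u x \<le> B * weighted_mass s u)"
    using local_boundedness[OF s lam, where 'a='a] by (elim exE conjE) (rule that)
  note harnack = harnack[rule_format] and bounded = bounded[rule_format]
  have main: "0 < weighted_mass s w \<and> weighted_mass s w \<le> A * (1 + B) \<and> (\<forall>x. norm x \<le> 3/4 \<longrightarrow> w x \<le> A * (1 + B)) \<and>
    (\<forall>x\<in>ball q (2 * r). 1 / (A * B) \<le> w x)"
    if K: "elliptic_kernel s lam Lam K" and w: "bounded_nonneg w" and cont: "continuous_on (ball 0 1) w"
      and sub: "subsol K w (ball 0 1)" and super: "supersol K w (ball 0 1 \<inter> \<Omega>)"
      and sup: "(SUP x\<in>ball 0 (1/2). w x) = 1" for K w
  proof -
    let ?I = "weighted_mass s w"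
    have "(SUP x\<in>ball 0 (1/2). w x) \<le> B * ?I"
      using bounded[OF K w cont sub] by (intro cSUP_least) auto
    then have I: "1 / B \<le> ?I" using B sup by (simp add: field_simps)
    have I0: "0 < ?I" using I B by (meson divide_pos_pos less_le_trans zero_less_one)
    have lower: "?I \<le> A * w x" if x: "x \<in> ball q (2 * r)" for x
    proof -
      have xb: "ball x (2 * r) \<subseteq> \<Omega> \<inter> ball 0 (1/2)"
      proof
        fix y assume "y \<in> ball x (2 * r)"
        then have "y \<in> ball q (4 * r)" using x dist_triangle[of q y x] by simp
        then show "y \<in> \<Omega> \<inter> ball 0 (1/2)" using q by blast
      qed
      then have "x \<in> ball 0 (1/2)" using r by (meson IntE centre_in_ball r2(1) subsetD)
      then have "norm x + 2 * r \<le> 1" using r by simp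
      moreover have "ball x (2 * r) \<subseteq> ball 0 1" using xb by fastforce
      ultimately show ?thesis
        using xb by (intro harnack[OF K w] supersol_subset[OF super] continuous_on_subset[OF cont]) auto
    qed
    have qq: "q \<in> ball q (2 * r)" using r by simp
    have "q \<in> ball q (4 * r)" using r by simp
    then have "q \<in> ball 0 (1/2)" using q by blast
    moreover have "bdd_above (w ` ball 0 (1/2))"
      using bounded_nonnegD(3)[OF w] unfolding bdd_above_def by blast
    ultimately have "w q \<le> 1" using cSUP_upper[of q "ball 0 (1/2)" w] sup by simp
    then have "A * w q \<le> A * 1" using A by (intro mult_left_mono) auto
    then have IA: "?I \<le> A" using lower[OF qq] by simp
    have "w x \<le> A * (1 + B)" if "norm x \<le> 3/4" for x
    proof -
      have "w x \<le> B * ?I" by (rule bounded[OF K w cont sub that])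
      also have "\<dots> \<le> B * A" using IA B by (intro mult_left_mono) auto
      also have "\<dots> \<le> A * (1 + B)" using A by (simp add: algebra_simps)
      finally show ?thesis .
    qed
    moreover have "?I \<le> A * (1 + B)" using IA mult_pos_pos[OF A B] by (simp add: distrib_left)
    moreover have "1 / (A * B) \<le> w x" if "x \<in> ball q (2 * r)" for x
      using order_trans[OF I lower[OF that]] A B by (simp add: field_simps)
    ultimately show ?thesis using I0 by blast
  qed
  show ?thesis
  proof (rule exI[of _ "A * (1 + B)"], rule conjI, goal_cases)
    case 2
    show ?case
    proof (rule exI[of _ "1 / (A * B)"], rule conjI)
      show "1 / (A * B) > 0" using A B by simp
    qed (intro allI impI, rule main, assumption+)
  qed (use A B in simp)
qed

theorem corollary1p4:
  fixes s lam Lam :: real and \<Omega> :: "(real ^ 'n) set"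
  assumes "0 < s" and "s < 1"
    and "0 < lam" and "lam \<le> Lam"
    and "C1_domain \<Omega>" and "0 \<in> frontier \<Omega>"
  shows "\<exists>C::real. 0 < inverse C \<and>
    (\<forall>L \<in> L_star s lam Lam. \<forall>u1 \<in> L_infty. \<forall>u2 \<in> L_infty.
       continuous_on (ball 0 1) u1 \<longrightarrow> continuous_on (ball 0 1) u2 \<longrightarrow>
       visc_eq L u1 (\<lambda>x. 0) (ball 0 1 \<inter> \<Omega>) \<longrightarrow> visc_eq L u2 (\<lambda>x. 0) (ball 0 1 \<inter> \<Omega>) \<longrightarrow>
       (\<forall>x \<in> ball 0 1 - \<Omega>. u1 x = 0 \<and> u2 x = 0) \<longrightarrow>
       (AE x in lebesgue. 0 \<le> u1 x) \<longrightarrow> (AE x in lebesgue. 0 \<le> u2 x) \<longrightarrow>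
       (SUP x \<in> ball 0 (1/2). u1 x) = 1 \<longrightarrow> (SUP x \<in> ball 0 (1/2). u2 x) = 1 \<longrightarrow>
       (\<forall>x \<in> ball 0 (1/2) \<inter> \<Omega>. inverse C \<le> u1 x / u2 x \<and> u1 x / u2 x \<le> C))"
proof -
  note s = assms(1,2) and lam = assms(3,4)
  have \<Omega>: "open \<Omega>" using assms(5) by (simp add: C1_domain_def)
  have "0 \<in> closure \<Omega>" using assms(6) by (simp add: frontier_def)
  then obtain q where q: "q \<in> \<Omega> \<inter> ball 0 (1/2)"
    unfolding closure_approachable by (metis IntI dist_commute half_gt_zero_iff mem_ball zero_less_one)
  have "open (\<Omega> \<inter> ball 0 (1/2))" using \<Omega> by auto
  then obtain e where e: "e > 0" "ball q e \<subseteq> \<Omega> \<inter> ball 0 (1/2)" using q openE by blast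
  \<comment> \<open>Fixed before the operator and the solutions, so every constant obtained from
    \<open>r\<close> is uniform in them.\<close>
  define r where "r = min (e / 4) (1/16)"
  have r: "0 < r" "r \<le> 1/16" using e by (auto simp: r_def)
  have "4 * r \<le> e" by (simp add: r_def)
  then have q4: "ball q (4 * r) \<subseteq> \<Omega> \<inter> ball 0 (1/2)" using e by (meson order_trans subset_ball)
  have q2: "ball q (2 * r) \<subseteq> ball 0 1"
  proof -
    have "ball q (2 * r) \<subseteq> ball q (4 * r)" using r by (intro subset_ball) simp
    moreover have "ball (0::real ^ 'n) (1/2) \<subseteq> ball 0 1" by (intro subset_ball) simp
    ultimately show ?thesis using q4 by blast
  qed
  obtain b c where b: "b > 0" and c: "c > 0" and norm_bounds:
    "\<forall>K w. elliptic_kernel s lam Lam K \<longrightarrow> bounded_nonneg w \<longrightarrow>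
      continuous_on (ball 0 1) w \<longrightarrow> subsol K w (ball 0 1) \<longrightarrow> supersol K w (ball 0 1 \<inter> \<Omega>) \<longrightarrow>
      (SUP x\<in>ball 0 (1/2). w x) = 1 \<longrightarrow>
      0 < weighted_mass s w \<and> weighted_mass s w \<le> b \<and> (\<forall>x. norm x \<le> 3/4 \<longrightarrow> w x \<le> b) \<and>
      (\<forall>x\<in>ball q (2 * r). c \<le> w x)"
    using normalized_bounds[OF s lam r q4] by (elim exE conjE) (rule that)
  note norm_bounds = norm_bounds[rule_format]
  obtain C where C: "C > 0" and compare:
    "\<forall>K (w1::real ^ 'n \<Rightarrow> real) w2 \<Omega> q. elliptic_kernel s lam Lam K \<longrightarrow>
      bounded_nonneg w1 \<longrightarrow> bounded_nonneg w2 \<longrightarrow> continuous_on (ball 0 1) w1 \<longrightarrow> continuous_on (ball 0 1) w2 \<longrightarrow>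
      open \<Omega> \<longrightarrow> (\<forall>x\<in>ball 0 1 - \<Omega>. w1 x = 0) \<longrightarrow>
      subsol K w1 (ball 0 1) \<longrightarrow> supersol K w2 (ball 0 1 \<inter> \<Omega>) \<longrightarrow>
      (\<forall>x. norm x \<le> 3/4 \<longrightarrow> w1 x \<le> b) \<longrightarrow> weighted_mass s w1 \<le> b \<longrightarrow>
      ball q (2 * r) \<subseteq> ball 0 1 \<longrightarrow> (\<forall>x\<in>ball q (2 * r). c \<le> w2 x) \<longrightarrow>
      (\<forall>p\<in>ball 0 (1/2). w1 p \<le> C * w2 p)"
    using boundary_comparison[OF s lam r b c, where 'a="real ^ 'n"] by (elim exE conjE) (rule that)
  have main: "inverse C \<le> u1 x / u2 x \<and> u1 x / u2 x \<le> C"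
    if L: "L \<in> L_star s lam Lam" and u: "u1 \<in> L_infty" "u2 \<in> L_infty"
      and cont: "continuous_on (ball 0 1) u1" "continuous_on (ball 0 1) u2"
      and visc: "visc_eq L u1 (\<lambda>x. 0) (ball 0 1 \<inter> \<Omega>)" "visc_eq L u2 (\<lambda>x. 0) (ball 0 1 \<inter> \<Omega>)"
      and out: "\<forall>x \<in> ball 0 1 - \<Omega>. u1 x = 0 \<and> u2 x = 0"
      and nonneg: "AE x in lebesgue. 0 \<le> u1 x" "AE x in lebesgue. 0 \<le> u2 x"
      and sup: "(SUP x \<in> ball 0 (1/2). u1 x) = 1" "(SUP x \<in> ball 0 (1/2). u2 x) = 1"
      and x: "x \<in> ball 0 (1/2) \<inter> \<Omega>" for L u1 u2 and x :: "real ^ 'n"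
  proof -
    obtain a where La: "L = nonlocal_op s a" and a: "(\<lambda>y. a (y /\<^sub>R norm y)) \<in> borel_measurable lebesgue"
      "\<And>\<theta>. \<theta> \<in> sphere 0 1 \<Longrightarrow> lam \<le> a \<theta> \<and> a \<theta> \<le> Lam"
      using L by (auto simp: L_star_def)
    define K where "K = (\<lambda>y. a (y /\<^sub>R norm y) / norm y powr (real DIM(real ^ 'n) + 2 * s))"
    have K: "elliptic_kernel s lam Lam K" unfolding K_def by (rule elliptic_kernel_sphere[OF a])
    have solution: "\<exists>w. bounded_nonneg w \<and> (\<forall>x\<in>ball 0 1. w x = u x) \<and> continuous_on (ball 0 1) w \<and>
        subsol K w (ball 0 1) \<and> supersol K w (ball 0 1 \<inter> \<Omega>) \<and> (SUP x\<in>ball 0 (1/2). w x) = 1"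
      if u: "u \<in> L_infty" "continuous_on (ball 0 1) u" "visc_eq L u (\<lambda>x. 0) (ball 0 1 \<inter> \<Omega>)"
        "\<And>x. x \<in> ball 0 1 - \<Omega> \<Longrightarrow> u x = 0" "AE x in lebesgue. 0 \<le> u x" "(SUP x\<in>ball 0 (1/2). u x) = 1"
      for u :: "real ^ 'n \<Rightarrow> real"
    proof -
      obtain w where w: "bounded_nonneg w" and wu: "\<And>x. x \<in> ball 0 1 \<Longrightarrow> w x = u x" "AE x in lebesgue. w x = u x"
        using bounded_nonneg_representative[OF u(1,5) open_ball u(2)] by blast
      have um: "u \<in> borel_measurable lebesgue" using u(1) by (simp add: L_infty_def)
      have sols: "subsol K w (ball 0 1 \<inter> \<Omega>)" "supersol K w (ball 0 1 \<inter> \<Omega>)"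
        using visc_imp_subsol_supersol[OF s K[unfolded K_def] lam um w wu(2) _ u(3)[unfolded La]] wu(1)
        unfolding K_def by auto
      have "subsol K w (ball 0 1)"
        by (rule subsol_extend_by_zero[OF s K lam w \<Omega> _ sols(1)]) (use u(4) wu(1) in auto)
      moreover have "continuous_on (ball 0 1) w" using u(2) wu(1) continuous_on_cong by metis
      moreover have "(SUP x\<in>ball 0 (1/2). w x) = (SUP x\<in>ball 0 (1/2). u x)"
        by (intro SUP_cong refl wu(1)) auto
      ultimately show ?thesis using w wu(1) sols(2) u(6) by auto
    qed
    have out1: "\<And>x. x \<in> ball 0 1 - \<Omega> \<Longrightarrow> u1 x = 0" and out2: "\<And>x. x \<in> ball 0 1 - \<Omega> \<Longrightarrow> u2 x = 0"
      using out by auto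
    obtain w1 where w1: "bounded_nonneg w1" "\<And>x. x \<in> ball 0 1 \<Longrightarrow> w1 x = u1 x" "continuous_on (ball 0 1) w1"
        "subsol K w1 (ball 0 1)" "supersol K w1 (ball 0 1 \<inter> \<Omega>)" "(SUP x\<in>ball 0 (1/2). w1 x) = 1"
      using solution[OF u(1) cont(1) visc(1) out1 nonneg(1) sup(1)] by blast
    obtain w2 where w2: "bounded_nonneg w2" "\<And>x. x \<in> ball 0 1 \<Longrightarrow> w2 x = u2 x" "continuous_on (ball 0 1) w2"
        "subsol K w2 (ball 0 1)" "supersol K w2 (ball 0 1 \<inter> \<Omega>)" "(SUP x\<in>ball 0 (1/2). w2 x) = 1"
      using solution[OF u(2) cont(2) visc(2) out2 nonneg(2) sup(2)] by blast
    note N1 = norm_bounds[OF K w1(1,3-6)] and N2 = norm_bounds[OF K w2(1,3-6)]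
    have x1: "x \<in> ball 0 1" and xh: "x \<in> ball 0 (1/2)" using x by auto
    have "w1 x \<le> C * w2 x"
      by (rule compare[rule_format, OF K w1(1) w2(1) w1(3) w2(3) \<Omega> _ w1(4) w2(5) _ _ q2 _ xh])
        (use N1 N2 out1 w1(2) in auto)
    then have le1: "u1 x \<le> C * u2 x" using w1(2)[OF x1] w2(2)[OF x1] by simp
    have "w2 x \<le> C * w1 x"
      by (rule compare[rule_format, OF K w2(1) w1(1) w2(3) w1(3) \<Omega> _ w2(4) w1(5) _ _ q2 _ xh])
        (use N1 N2 out2 w2(2) in auto)
    then have le2: "u2 x \<le> C * u1 x" using w1(2)[OF x1] w2(2)[OF x1] by simp
    \<comment> \<open>Strict positivity makes the quotient meaningful, since division by 0 would
      return 0. The Harnack constant may depend on \<open>x\<close> here because only the sign is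
      used.\<close>
    have "0 < w2 x"
    proof -
      have "open (\<Omega> \<inter> ball 0 1)" using \<Omega> by auto
      then obtain d where d: "d > 0" "ball x d \<subseteq> \<Omega> \<inter> ball 0 1" using x x1 openE by blast
      define d' where "d' = min d (1/2)"
      have d': "0 < d'" "d' \<le> 1" using d by (auto simp: d'_def)
      have "ball x d' \<subseteq> ball x d" by (intro subset_ball) (simp add: d'_def)
      then have sub: "ball x d' \<subseteq> ball 0 1 \<inter> \<Omega>" using d by blast
      have nx: "norm x + d' \<le> 1" using xh by (simp add: d'_def)
      obtain A where A: "A > 0" and harnack: "\<forall>K u (p::real ^ 'n). elliptic_kernel s lam Lam K \<longrightarrow>
          bounded_nonneg u \<longrightarrow> norm p + d' \<le> 1 \<longrightarrow> continuous_on (ball p d') u \<longrightarrow>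
          supersol K u (ball p d') \<longrightarrow> weighted_mass s u \<le> A * u p"
        using weak_harnack[OF s lam d', where 'a="real ^ 'n"] by (elim exE conjE) (rule that)
      have "weighted_mass s w2 \<le> A * w2 x"
        using sub by (intro harnack[rule_format, OF K w2(1) nx] supersol_subset[OF w2(5)] continuous_on_subset[OF w2(3)]) auto
      then show ?thesis using N2 A by (meson less_le_trans zero_less_mult_pos)
    qed
    then have "0 < u2 x" using w2(2)[OF x1] by simp
    then show ?thesis using le1 le2 C by (simp add: field_simps)
  qed
  show ?thesis
  proof (rule exI[of _ C], rule conjI)
    show "0 < inverse C" using C by simp
  qed (intro ballI impI, rule main, assumption+)
qed

end
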